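(* With $\mathcal{L}$, $\mathsf{W}_{(N,q/p)}$ and the dilatation $\lambda$ as in the context, the following inequalities hold. (i) $\lambda(\mathsf{W}_{(N,q/p)})<\lambda(\mathsf{W}_{(N+1,q/p)})$ for every $(N,\frac{q}{p})\in\mathcal{L}$. (ii) $\lambda(\mathsf{W}_{(N,s/r)})<\lambda(\mathsf{W}_{(N,q/p)})$ for all $(N,\frac{s}{r}),(N,\frac{q}{p})\in\mathcal{L}$ such that $\frac{q}{p}$ is a descendant of $\frac{s}{r}$ in the Stern-Brocot tree.
   Context: $\mathbb{N}$ is the set of positive integers; rationals $\xi=q/p\ge 0$ are written with $p>0$, $q\ge0$, $\gcd(p,q)=1$. $\mathcal{B}_3=B_3/\langle(\sigma_1\sigma_2)^3\rangle$ with $B_3=\langle\sigma_1,\sigma_2\mid\sigma_1\sigma_2\sigma_1=\sigma_2\sigma_1\sigma_2\rangle$, $\bar\sigma_i$ the image of $\sigma_i$, identified with $\mathrm{PSL}_2(\mathbb{Z})$ by $\bar\sigma_1\mapsto\pm\begin{pmatrix}1&0\\-1&1\end{pmatrix}$, $\bar\sigma_2\mapsto\pm\begin{pmatrix}1&1\\0&1\end{pmatrix}$. An element $\beta\in\mathcal{B}_3$ is pseudo-Anosov if its matrix is hyperbolic ($|\mathrm{trace}|>2$); its dilatation $\lambda(\beta)>1$ is the largest absolute value of an eigenvalue of the matrix. It depends only on the conjugacy class of $\beta$. Put $\mathsf{A}=\bar\sigma_1\bar\sigma_2\bar\sigma_1$, $\mathsf{B}=\bar\sigma_1\bar\sigma_2$;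 $\mathsf{A}^2=\mathsf{B}^3=1$. Let $\mathscr{P}_0$ be the set of $(m,n)\in\mathbb{Z}^2$ with $\gcd(m,n)=1$, $m\equiv n\equiv1\pmod 3$, $m\not\equiv n\pmod 6$, $mn<0$, $|m|<|n|\le2|m|$. For $(m,n)\in\mathscr{P}_0$ put $\ell=(m-n)/3$ (an odd integer); for $1\le k\le 2|m|$ let $\varepsilon'_k\in\{0,1\}$ with $\varepsilon'_k\equiv\lfloor\frac{|\ell|}{|m|}k-\frac{|\ell|}{2|m|}\rfloor\pmod 2$ and $\varepsilon_k=\mathrm{sgn}(m\ell)(2\varepsilon'_k-1)\in\{\pm1\}$, and set $$\mathsf{W}_{m,n}=\mathsf{A}^{\frac{1-\mathrm{sgn}(m)\varepsilon_1}{2}}\,\mathsf{B}^{\varepsilon_1}\mathsf{A}^{\frac{\varepsilon_1-\varepsilon_2}{2}}\mathsf{B}^{\varepsilon_2}\mathsf{A}^{\frac{\varepsilon_2-\varepsilon_3}{2}}\cdots\mathsf{B}^{\varepsilon_{2|m|}}\,\mathsf{A}^{\frac{1-\mathrm{sgn}(m)\varepsilon_{2|m|}}{2}}\in\mathcal{B}_3 .$$ The Lissajous class $C\{m,n\}$ is the conjugacy class of $\mathsf{W}_{m,n}$ in $\mathcal{B}_3$; it is a pseudo-Anosov class. Let $\mathcal{L}=\{(N,q/p)\in\mathbb{N}\times\mathbb{Q}_{\ge0}\mid \gcd(p,q)=\gcd(p+q,6)=1\}$. There is a bijection $\mathscr{P}_0\to\mathcal{L}$, $(m,n)\mapsto(N,q/p)$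 (level and slope), where $N$ is the unique positive integer with $\frac{3N+2}{3N+1}<-\frac nm\le\frac{3N-1}{3N-2}$ and $p=(3N+1)|\ell|-(2N+1)|m|$, $q=-(3N-2)|\ell|+(2N-1)|m|$. For $(N,q/p)\in\mathcal{L}$ corresponding to $(m,n)\in\mathscr{P}_0$, $\mathsf{W}_{(N,q/p)}\in\mathcal{B}_3$ denotes a representative of the class $C\{m,n\}$ (the value of $\lambda$ does not depend on the choice). Stern-Brocot tree: the infinite complete binary tree whose vertices are the positive rational numbers, each occurring once, with root $\frac11$, in which each vertex equals $\frac{q+q'}{p+p'}$, where $\frac qp$ is its nearest ancestor above and to the left ($\frac01$ if there is none) and $\frac{q'}{p'}$ is its nearest ancestor above and to the right ($\frac10$ if there is none). *)

theory Defs
  imports "Jordan_Normal_Form.Spectral_Radius" "HOL-Number_Theory.Cong"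
begin

section \<open>The quotient of the braid group on three strands by its centre\<close>

datatype gen = S1 | S2

text \<open>A word is a list of letters \<open>(g, e)\<close>, standing for \<open>g\<close> if \<open>e\<close> holds and for the inverse of
  \<open>g\<close> otherwise.\<close>

type_synonym word = "(gen \<times> bool) list"

text \<open>The group congruence on words for the presentation
  \<open>\<langle>s1, s2 | s1 s2 s1 = s2 s1 s2, (s1 s2)^3 = 1\<rangle>\<close>.\<close>

inductive braid_eq :: "word \<Rightarrow> word \<Rightarrow> bool" where
  refl: "braid_eq w w"
| sym: "braid_eq w w' \<Longrightarrow> braid_eq w' w"
| trans: "braid_eq w w' \<Longrightarrow> braid_eq w' w'' \<Longrightarrow> braid_eq w w''"
| ctxt: "braid_eq w w' \<Longrightarrow> braid_eq (u @ w @ v) (u @ w' @ v)"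
| cancel: "braid_eq [(g, e), (g, \<not> e)] []"
| braid: "braid_eq [(S1, True), (S2, True), (S1, True)] [(S2, True), (S1, True), (S2, True)]"
| central: "braid_eq [(S1, True), (S2, True), (S1, True), (S2, True), (S1, True), (S2, True)] []"

definition word_inverse :: "word \<Rightarrow> word" where
  "word_inverse w = rev (map (\<lambda>(g, e). (g, \<not> e)) w)"

lemma braid_eq_append:
  assumes "braid_eq u u'" "braid_eq v v'"
  shows "braid_eq (u @ v) (u' @ v')"
  using braid_eq.ctxt[OF assms(1), of "[]" v] braid_eq.ctxt[OF assms(2), of u' "[]"]
  by (auto intro: braid_eq.trans)

lemma word_inverse_append: "word_inverse (u @ v) = word_inverse v @ word_inverse u"
  by (simp add: word_inverse_def)

lemma word_inverse_idem: "word_inverse (word_inverse w) = w"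
  by (simp add: word_inverse_def rev_map comp_def case_prod_unfold)

lemma braid_eq_word_inverse_right: "braid_eq (w @ word_inverse w) []"
proof (induction w)
  case Nil
  show ?case by (simp add: word_inverse_def braid_eq.refl)
next
  case (Cons x w)
  obtain g e where x: "x = (g, e)" by (cases x)
  have "braid_eq ([x] @ (w @ word_inverse w) @ [(g, \<not> e)]) ([x] @ [] @ [(g, \<not> e)])"
    by (rule braid_eq.ctxt[OF Cons.IH])
  moreover have "braid_eq ([x] @ [] @ [(g, \<not> e)]) []"
    using braid_eq.cancel[of g e] by (simp add: x)
  ultimately show ?case
    by (auto simp: x word_inverse_def intro: braid_eq.trans)
qed

lemma braid_eq_word_inverse_left: "braid_eq (word_inverse w @ w) []"
  using braid_eq_word_inverse_right[of "word_inverse w"] by (simp add: word_inverse_idem)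

lemma braid_eq_word_inverse:
  assumes "braid_eq w w'"
  shows "braid_eq (word_inverse w) (word_inverse w')"
proof -
  have "braid_eq (word_inverse w) (word_inverse w @ (w' @ word_inverse w'))"
    using braid_eq_append[OF braid_eq.refl braid_eq.sym[OF braid_eq_word_inverse_right],
        of "word_inverse w" w'] by simp
  moreover have "braid_eq (word_inverse w @ w' @ word_inverse w')
      (word_inverse w @ w @ word_inverse w')"
    by (rule braid_eq.ctxt[OF braid_eq.sym[OF assms]])
  moreover have "braid_eq ((word_inverse w @ w) @ word_inverse w') ([] @ word_inverse w')"
    by (rule braid_eq_append[OF braid_eq_word_inverse_left braid_eq.refl])
  ultimately show ?thesis
    by (metis append.assoc append_Nil braid_eq.trans)
qed

text \<open>The quotient of \<open>B\<^sub>3\<close> by the subgroup generated by \<open>(s1 s2)^3\<close>. This subgroup is central, hence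
  normal, so that the quotient is presented by adding the relation \<open>(s1 s2)^3 = 1\<close>.\<close>

quotient_type braid3 = word / braid_eq
  by (rule equivpI) (auto intro: reflpI sympI transpI braid_eq.refl braid_eq.sym braid_eq.trans)

instantiation braid3 :: "{monoid_mult, inverse}"
begin

lift_definition one_braid3 :: braid3 is "[]" .

lift_definition times_braid3 :: "braid3 \<Rightarrow> braid3 \<Rightarrow> braid3" is "(@)"
  by (rule braid_eq_append)

lift_definition inverse_braid3 :: "braid3 \<Rightarrow> braid3" is word_inverse
  by (rule braid_eq_word_inverse)

definition divide_braid3 :: "braid3 \<Rightarrow> braid3 \<Rightarrow> braid3" where
  "divide_braid3 x y = x * inverse y"

instance
  by standard (transfer, simp add: braid_eq.refl)+

end

lemma braid3_inverse_left: "inverse x * x = (1 :: braid3)"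
  by transfer (rule braid_eq_word_inverse_left)

lemma braid3_inverse_right: "x * inverse x = (1 :: braid3)"
  by transfer (rule braid_eq_word_inverse_right)

lift_definition \<sigma>1 :: braid3 is "[(S1, True)]" .

lift_definition \<sigma>2 :: braid3 is "[(S2, True)]" .

definition conj_class :: "braid3 \<Rightarrow> braid3 set" where
  "conj_class x = {g * x * inverse g | g. True}"


section \<open>Matrices and dilatation\<close>

fun letter_matrix :: "gen \<times> bool \<Rightarrow> int mat" where
  "letter_matrix (S1, True) = mat_of_rows_list 2 [[1, 0], [-1, 1]]"
| "letter_matrix (S1, False) = mat_of_rows_list 2 [[1, 0], [1, 1]]"
| "letter_matrix (S2, True) = mat_of_rows_list 2 [[1, 1], [0, 1]]"
| "letter_matrix (S2, False) = mat_of_rows_list 2 [[1, -1], [0, 1]]"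

fun word_matrix :: "word \<Rightarrow> int mat" where
  "word_matrix [] = 1\<^sub>m 2"
| "word_matrix (x # w) = letter_matrix x * word_matrix w"

lemma letter_matrix_carrier [simp]: "letter_matrix x \<in> carrier_mat 2 2"
  by (cases x rule: letter_matrix.cases) (auto simp: mat_of_rows_list_def)

lemma word_matrix_carrier [simp]: "word_matrix w \<in> carrier_mat 2 2"
  by (induction w) (auto intro: mult_carrier_mat[OF letter_matrix_carrier])

lemma word_matrix_append: "word_matrix (u @ v) = word_matrix u * word_matrix v"
proof (induction u)
  case Nil
  show ?case by (simp add: left_mult_one_mat[OF word_matrix_carrier])
next
  case (Cons x u)
  then show ?case
    by (simp add: assoc_mult_mat[OF letter_matrix_carrier word_matrix_carrier word_matrix_carrier])
qed

lemma uminus_mult_context: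
  fixes U W V :: "int mat"
  assumes "U \<in> carrier_mat 2 2" "W \<in> carrier_mat 2 2" "V \<in> carrier_mat 2 2"
  shows "U * ((- W) * V) = - (U * (W * V))"
  using assms by simp

lemma mat2_eqI:
  fixes A B :: "int mat"
  assumes "A \<in> carrier_mat 2 2" "B \<in> carrier_mat 2 2"
    and "A $$ (0, 0) = B $$ (0, 0)" "A $$ (0, 1) = B $$ (0, 1)"
    and "A $$ (1, 0) = B $$ (1, 0)" "A $$ (1, 1) = B $$ (1, 1)"
  shows "A = B"
  using assms by (intro eq_matI) (auto simp: less_2_cases_iff)

lemmas mat2_eval = mat_of_rows_list_def scalar_prod_def numeral_2_eq_2 less_Suc_eq_0_disj

lemma word_matrix_braid_eq:
  assumes "braid_eq w w'"
  shows "word_matrix w = word_matrix w' \<or> word_matrix w = - word_matrix w'"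
  using assms
proof (induction rule: braid_eq.induct)
  case (refl w)
  show ?case by simp
next
  case (sym w w')
  then show ?case by auto
next
  case (trans w w' w'')
  then show ?case by auto
next
  case (ctxt w w' u v)
  then show ?case
    by (auto simp: word_matrix_append uminus_mult_context)
next
  case (cancel g e)
  have "word_matrix [(g, e), (g, \<not> e)] = word_matrix []"
    by (rule mat2_eqI; (rule word_matrix_carrier)?; cases g; cases e; simp add: mat2_eval)
  then show ?case ..
next
  case braid
  have "word_matrix [(S1, True), (S2, True), (S1, True)] =
      word_matrix [(S2, True), (S1, True), (S2, True)]"
    by (rule mat2_eqI; (rule word_matrix_carrier)?; simp add: mat2_eval)
  then show ?case ..
next
  case central
  have "word_matrix [(S1, True), (S2, True), (S1, True), (S2, True), (S1, True), (S2, True)] =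
      - word_matrix []"
    by (rule mat2_eqI; (rule word_matrix_carrier uminus_carrier_mat)?; simp add: mat2_eval)
  then show ?case ..
qed

lemma eigenvalue_uminus_imp:
  fixes A :: "complex mat"
  assumes A: "A \<in> carrier_mat n n" and "eigenvalue A k"
  shows "eigenvalue (- A) (- k)"
proof -
  from assms obtain v where v: "v \<in> carrier_vec n" "v \<noteq> 0\<^sub>v n" "A *\<^sub>v v = k \<cdot>\<^sub>v v"
    by (auto simp: eigenvalue_def eigenvector_def)
  have "(- A) *\<^sub>v v = - (A *\<^sub>v v)"
    using A v(1) by (intro eq_vecI) auto
  also have "\<dots> = (- k) \<cdot>\<^sub>v v"
    by (auto simp: v(3))
  finally show ?thesis
    using A v by (auto simp: eigenvalue_def eigenvector_def)
qed

lemma spectral_radius_uminus: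
  fixes A :: "complex mat"
  assumes A: "A \<in> carrier_mat n n"
  shows "spectral_radius (- A) = spectral_radius A"
proof -
  have "eigenvalue (- A) k \<longleftrightarrow> eigenvalue A (- k)" for k
    using eigenvalue_uminus_imp[OF A, of "- k"]
      eigenvalue_uminus_imp[of "- A" n k] A by auto
  then have "spectrum (- A) = uminus ` spectrum A"
    by (force simp: spectrum_def image_iff)
  then show ?thesis
    by (simp add: spectral_radius_def image_image)
qed

text \<open>Sending the generators to the classes of their matrices identifies \<open>braid3\<close> with the group of
  integer matrices of determinant 1 modulo sign. The largest absolute value of an eigenvalue does
  not depend on the sign of the matrix. For a hyperbolic matrix all eigenvalues are real.\<close>

lift_definition dilatation :: "braid3 \<Rightarrow> real" is
  "\<lambda>w. spectral_radius (map_mat of_int (word_matrix w))"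
proof -
  fix w w'
  assume "braid_eq w w'"
  then consider "word_matrix w = word_matrix w'" | "word_matrix w = - word_matrix w'"
    using word_matrix_braid_eq by blast
  then show "spectral_radius (map_mat of_int (word_matrix w)) =
      spectral_radius (map_mat of_int (word_matrix w'))"
  proof cases
    case 2
    have "map_mat complex_of_int (- word_matrix w') = - map_mat complex_of_int (word_matrix w')"
      by (intro eq_matI) auto
    with 2 show ?thesis
      using spectral_radius_uminus[of "map_mat complex_of_int (word_matrix w')" 2] by simp
  qed simp
qed


section \<open>Lissajous classes\<close>

definition P0 :: "(int \<times> int) set" where
  "P0 = {(m, n). coprime m n \<and> [m = 1] (mod 3) \<and> [n = 1] (mod 3) \<and> \<not> [m = n] (mod 6) \<and>
     m * n < 0 \<and> \<bar>m\<bar> < \<bar>n\<bar> \<and> \<bar>n\<bar> \<le> 2 * \<bar>m\<bar>}"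

text \<open>On \<open>P0\<close> the difference \<open>m - n\<close> is an odd multiple of 3, so the division is exact.\<close>

definition ell :: "int \<Rightarrow> int \<Rightarrow> int" where
  "ell m n = (m - n) div 3"

definition eps :: "int \<Rightarrow> int \<Rightarrow> int \<Rightarrow> int" where
  "eps m n k =
    (let l = ell m n;
         e = \<lfloor>real_of_int \<bar>l\<bar> / real_of_int \<bar>m\<bar> * real_of_int k -
               real_of_int \<bar>l\<bar> / (2 * real_of_int \<bar>m\<bar>)\<rfloor> mod 2
     in sgn (m * l) * (2 * e - 1))"

text \<open>All exponents of \<open>A\<close> below are divisions of even numbers, since \<open>eps m n k\<close> is 1 or -1. The
  product over the list runs through its factors from left to right.\<close>

definition lissajous_word :: "int \<Rightarrow> int \<Rightarrow> braid3" where
  "lissajous_word m n =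
    (let A = \<sigma>1 * \<sigma>2 * \<sigma>1; B = \<sigma>1 * \<sigma>2; \<epsilon> = eps m n; K = 2 * \<bar>m\<bar>
     in A powi ((1 - sgn m * \<epsilon> 1) div 2) * B powi \<epsilon> 1 *
        prod_list (map (\<lambda>k. A powi ((\<epsilon> (k - 1) - \<epsilon> k) div 2) * B powi \<epsilon> k) [2..K]) *
        A powi ((1 - sgn m * \<epsilon> K) div 2))"

definition lissajous_class :: "int \<Rightarrow> int \<Rightarrow> braid3 set" where
  "lissajous_class m n = conj_class (lissajous_word m n)"

definition level :: "int \<Rightarrow> int \<Rightarrow> nat" where
  "level m n = (THE N. N \<ge> 1 \<and>
     (3 * rat_of_nat N + 2) / (3 * rat_of_nat N + 1) < - rat_of_int n / rat_of_int m \<and>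
     - rat_of_int n / rat_of_int m \<le> (3 * rat_of_nat N - 1) / (3 * rat_of_nat N - 2))"

definition slope :: "int \<Rightarrow> int \<Rightarrow> rat" where
  "slope m n =
    (let N = int (level m n); l = \<bar>ell m n\<bar>;
         p = (3 * N + 1) * l - (2 * N + 1) * \<bar>m\<bar>;
         q = - (3 * N - 2) * l + (2 * N - 1) * \<bar>m\<bar>
     in of_int q / of_int p)"

definition level_slope :: "int \<times> int \<Rightarrow> nat \<times> rat" where
  "level_slope = (\<lambda>(m, n). (level m n, slope m n))"

text \<open>\<open>quotient_of \<xi>\<close> is the pair of numerator and positive denominator of \<open>\<xi>\<close> in lowest terms.\<close>

definition LL :: "(nat \<times> rat) set" where
  "LL = {(N, \<xi>). N \<ge> 1 \<and> \<xi> \<ge> 0 \<and> (let (q, p) = quotient_of \<xi> in coprime (p + q) 6)}"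

text \<open>The Lissajous class of given level and slope, through the inverse of the bijection
  \<open>level_slope\<close> from \<open>P0\<close> to \<open>LL\<close>.\<close>

definition lissajous_class_at :: "nat \<times> rat \<Rightarrow> braid3 set" where
  "lissajous_class_at x = (case inv_into P0 level_slope x of (m, n) \<Rightarrow> lissajous_class m n)"


section \<open>The Stern-Brocot tree\<close>

datatype dir = Left | Right

text \<open>A node is addressed by the steps leading from the root to it, with the \<^emph>\<open>last\<close> step at the head
  of the list, so that the descendants of \<open>u\<close> are the nodes \<open>v @ u\<close> with \<open>v\<close> nonempty. A fraction \<open>q/p\<close>
  is the pair \<open>(q, p)\<close>, which allows for \<open>1/0\<close>. The function \<open>sb_neighbours\<close> returns the nearest
  ancestors above and to the left and above and to the right: a node is to the left of everything in
  its right subtree and to the right of everything in its left subtree.\<close>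

definition mediant :: "(nat \<times> nat) \<times> (nat \<times> nat) \<Rightarrow> nat \<times> nat" where
  "mediant = (\<lambda>((q, p), (q', p')). (q + q', p + p'))"

fun sb_neighbours :: "dir list \<Rightarrow> (nat \<times> nat) \<times> (nat \<times> nat)" where
  "sb_neighbours [] = ((0, 1), (1, 0))"
| "sb_neighbours (Left # u) = (fst (sb_neighbours u), mediant (sb_neighbours u))"
| "sb_neighbours (Right # u) = (mediant (sb_neighbours u), snd (sb_neighbours u))"

definition sb_vertex :: "dir list \<Rightarrow> rat" where
  "sb_vertex u = (case mediant (sb_neighbours u) of (q, p) \<Rightarrow> of_nat q / of_nat p)"

definition sb_descendant :: "rat \<Rightarrow> rat \<Rightarrow> bool" where
  "sb_descendant x y \<longleftrightarrow> (\<exists>u v. v \<noteq> [] \<and> y = sb_vertex u \<and> x = sb_vertex (v @ u))"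

end

theory Submission
  imports Defs
begin

text \<open>Put \<open>n = p + q\<close>. Up to conjugation and sign, the matrix of \<open>W\<^bsub>(N,q/p)\<^esub>\<close> is an alternating
  product of \<open>2 n\<close> powers of the upper and the lower elementary unipotent matrix, hence a product of
  continued fraction matrices \<open>[[c, 1], [1, 0]]\<close>. The digits \<open>c\<close> are \<open>2 N - 1\<close> and \<open>2 N + 1\<close>,
  distributed with period \<open>n\<close> like the increments of the rounded multiples of \<open>q / n\<close>, that is, like the letters of a Christoffel word.
  The dilatation is an increasing function of the trace of this product.

  Raising \<open>N\<close> raises every digit, hence the trace. If \<open>q / p\<close> is a descendant of \<open>s / r\<close>, then the
  Christoffel word of \<open>s / r\<close> is a prefix or a suffix of that of \<open>q / p\<close>. Both words have odd length,
  so the remaining factor has even length; its matrix exceeds the identity entrywise, and the trace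
  grows.\<close>

section \<open>Two-by-two integer matrices\<close>

text \<open>With the size fixed by the type, multiplication is total and associative, so matrices
  form a monoid to which \<open>prod_list\<close> applies; \<open>to_mat\<close> leads back to
  \<open>int mat\<close>.\<close>

datatype mat2 = Mat2 int int int int

instantiation mat2 :: "{monoid_mult, uminus}"
begin

definition "1 = Mat2 1 0 0 1"

fun times_mat2 where
  "Mat2 a b c d * Mat2 a' b' c' d' =
    Mat2 (a * a' + b * c') (a * b' + b * d') (c * a' + d * c') (c * b' + d * d')"

fun uminus_mat2 where
  "- Mat2 a b c d = Mat2 (- a) (- b) (- c) (- d)"

instance
proof
  fix A B C :: mat2
  show "A * B * C = A * (B * C)" by (cases A; cases B; cases C; simp add: algebra_simps)
  show "1 * A = A" "A * 1 = A" by (cases A; simp add: one_mat2_def)+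
qed

end

fun tr2 :: "mat2 \<Rightarrow> int" where "tr2 (Mat2 a b c d) = a + d"

fun det2 :: "mat2 \<Rightarrow> int" where "det2 (Mat2 a b c d) = a * d - b * c"

text \<open>On matrices of determinant 1 the adjugate is the inverse; it reverses products and
  commutes with the sign without any side condition.\<close>

fun adj2 :: "mat2 \<Rightarrow> mat2" where "adj2 (Mat2 a b c d) = Mat2 d (- b) (- c) a"

fun entrywise_le :: "mat2 \<Rightarrow> mat2 \<Rightarrow> bool"  (infix "\<preceq>" 50) where
  "Mat2 a b c d \<preceq> Mat2 a' b' c' d' \<longleftrightarrow> a \<le> a' \<and> b \<le> b' \<and> c \<le> c' \<and> d \<le> d'"

abbreviation zero2 :: mat2 where "zero2 \<equiv> Mat2 0 0 0 0"

lemma tr2_mult_commute: "tr2 (A * B) = tr2 (B * A)"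
  by (cases A; cases B) (simp add: algebra_simps)

lemma det2_mult: "det2 (A * B) = det2 A * det2 B"
  by (cases A; cases B) (simp add: algebra_simps)

lemma det2_uminus: "det2 (- A) = det2 A"
  by (cases A) simp

lemma mat2_mult_uminus: "- A * B = - (A * B)" "A * - B = - (A * B)" "- (- A) = (A :: mat2)"
  by (cases A; cases B; simp)+

lemma adj2_mult: "adj2 (A * B) = adj2 B * adj2 A"
  by (cases A; cases B) (simp add: algebra_simps)

lemma adj2_uminus: "adj2 (- A) = - adj2 A"
  by (cases A) simp

lemma tr2_conj: "det2 G = 1 \<Longrightarrow> tr2 (G * P * adj2 G) = tr2 P"
proof -
  assume "det2 G = 1"
  then have "adj2 G * G = 1" by (cases G) (simp add: one_mat2_def algebra_simps)
  then show ?thesis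
    by (simp add: tr2_mult_commute[of "G * P"] mult.assoc[symmetric])
qed

lemma entrywise_le_refl: "A \<preceq> A"
  by (cases A) simp

lemma entrywise_le_trans: "A \<preceq> B \<Longrightarrow> B \<preceq> C \<Longrightarrow> A \<preceq> C"
  by (cases A; cases B; cases C) auto

lemma entrywise_le_mult:
  assumes "A \<preceq> A'" "B \<preceq> B'" "zero2 \<preceq> A" "zero2 \<preceq> B"
  shows "A * B \<preceq> A' * B'"
  using assms by (cases A; cases A'; cases B; cases B') (auto intro!: add_mono mult_mono)

lemma tr2_mono: "A \<preceq> B \<Longrightarrow> tr2 A \<le> tr2 B"
  by (cases A; cases B) auto

section \<open>Products along sequences\<close>

definition seq_prod :: "(nat \<Rightarrow> 'a::monoid_mult) \<Rightarrow> nat \<Rightarrow> nat \<Rightarrow> 'a" where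
  "seq_prod f a b = prod_list (map f [a..<b])"

lemma seq_prod_same [simp]: "seq_prod f a a = 1"
  by (simp add: seq_prod_def)

lemma seq_prod_Suc: "a \<le> b \<Longrightarrow> seq_prod f a (Suc b) = seq_prod f a b * f b"
  by (simp add: seq_prod_def)

lemma seq_prod_Cons: "a < b \<Longrightarrow> seq_prod f a b = f a * seq_prod f (Suc a) b"
  by (simp add: seq_prod_def upt_conv_Cons)

lemma seq_prod_split: "a \<le> b \<Longrightarrow> b \<le> c \<Longrightarrow> seq_prod f a c = seq_prod f a b * seq_prod f b c"
  using upt_add_eq_append[of a b "c - b"] by (simp add: seq_prod_def)

lemma seq_prod_cong: "(\<And>i. a \<le> i \<Longrightarrow> i < b \<Longrightarrow> f i = g i) \<Longrightarrow> seq_prod f a b = seq_prod g a b"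
  unfolding seq_prod_def by (intro arg_cong[of _ _ prod_list] map_cong) auto

lemma seq_prod_shift: "seq_prod f (a + k) (b + k) = seq_prod (\<lambda>i. f (i + k)) a b"
proof -
  have "[a + k..<b + k] = map (\<lambda>i. i + k) [a..<b]"
    by (rule nth_equalityI) auto
  then show ?thesis by (simp add: seq_prod_def comp_def)
qed

lemma seq_prod_regroup:
  assumes "mono T" "T 0 = 0"
  shows "seq_prod f 0 (T k) = seq_prod (\<lambda>i. seq_prod f (T i) (T (Suc i))) 0 k"
proof (induction k)
  case (Suc k)
  have "seq_prod f 0 (T (Suc k)) = seq_prod f 0 (T k) * seq_prod f (T k) (T (Suc k))"
    by (intro seq_prod_split) (auto intro: monoD[OF assms(1)])
  then show ?case by (simp add: seq_prod_Suc Suc.IH)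
qed (simp add: assms)

text \<open>Moving the window by one place carries its first factor to the end, by periodicity, and
  cyclic invariance of the trace absorbs this.\<close>

lemma tr2_seq_prod_periodic:
  assumes "\<And>i. f (i + n) = f i"
  shows "tr2 (seq_prod f a (a + n)) = tr2 (seq_prod f 0 n)"
proof (induction a)
  case (Suc a)
  show ?case
  proof (cases "n = 0")
    case False
    then have "tr2 (seq_prod f (Suc a) (Suc a + n)) = tr2 (seq_prod f (Suc a) (a + n) * f a)"
      by (simp add: seq_prod_Suc assms)
    also have "\<dots> = tr2 (f a * seq_prod f (Suc a) (a + n))"
      by (rule tr2_mult_commute)
    also have "f a * seq_prod f (Suc a) (a + n) = seq_prod f a (a + n)"
      using False by (simp add: seq_prod_Cons)
    finally show ?thesis using Suc.IH by simp
  qed simp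
qed simp

section \<open>Continued fraction matrices\<close>

definition cf_mat :: "int \<Rightarrow> mat2" where "cf_mat c = Mat2 c 1 1 0"

lemma seq_prod_cf_mat_mono:
  assumes "\<And>i. 0 \<le> c i" "\<And>i. c i \<le> c' i" "a \<le> b"
  shows "zero2 \<preceq> seq_prod (\<lambda>i. cf_mat (c i)) a b \<and>
    seq_prod (\<lambda>i. cf_mat (c i)) a b \<preceq> seq_prod (\<lambda>i. cf_mat (c' i)) a b"
  using assms(3)
proof (induction b rule: dec_induct)
  case base
  show ?case by (simp add: one_mat2_def)
next
  case (step b)
  have *: "zero2 \<preceq> cf_mat (c b)" "cf_mat (c b) \<preceq> cf_mat (c' b)"
    using assms by (simp_all add: cf_mat_def)
  have "zero2 * zero2 \<preceq> seq_prod (\<lambda>i. cf_mat (c i)) a b * cf_mat (c b)"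
    by (rule entrywise_le_mult) (use step * in auto)
  then show ?case
    using step * by (simp add: seq_prod_Suc entrywise_le_mult)
qed

text \<open>The square of \<open>cf_mat 1\<close> dominates the identity, so two more factors cannot
  lower a nonnegative product.\<close>

lemma seq_prod_cf_mat_one_add_even:
  "cf_mat 1 \<preceq> cf_mat 1 * seq_prod (\<lambda>_. cf_mat 1) a (a + 2 * k)"
proof (induction k)
  case 0
  show ?case by (simp add: entrywise_le_refl)
next
  case (Suc k)
  have "cf_mat 1 \<preceq> cf_mat 1 * (cf_mat 1 * cf_mat 1)" by (simp add: cf_mat_def)
  also have *: "\<dots> \<preceq> (cf_mat 1 * seq_prod (\<lambda>_. cf_mat 1) a (a + 2 * k)) * (cf_mat 1 * cf_mat 1)"
    by (rule entrywise_le_mult[OF Suc.IH]) (simp_all add: cf_mat_def)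
  note entrywise_le_trans[OF calculation *]
  then show ?case by (simp add: seq_prod_Suc mult.assoc)
qed

lemma seq_prod_cf_mat_odd:
  assumes "\<And>i. 1 \<le> c i" "a < b" "odd (b - a)"
  shows "cf_mat 1 \<preceq> seq_prod (\<lambda>i. cf_mat (c i)) a b"
proof -
  obtain k where b: "b = Suc a + 2 * k"
    using that[of "(b - a) div 2"] assms(2,3) by (simp add: odd_two_times_div_two_succ)
  have "cf_mat 1 \<preceq> seq_prod (\<lambda>_. cf_mat 1) a b"
    using seq_prod_cf_mat_one_add_even[of "Suc a" k] assms(2) by (simp add: seq_prod_Cons b)
  with seq_prod_cf_mat_mono[of "\<lambda>_. 1" c a b] assms show ?thesis
    by (auto intro: entrywise_le_trans)
qed

text \<open>The bound by the square of \<open>cf_mat 1\<close>, rather than by the identity, is what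
  later makes traces grow strictly; the empty product fails it.\<close>

lemma seq_prod_cf_mat_even:
  assumes "\<And>i. 1 \<le> c i" "a < b" "even (b - a)"
  shows "cf_mat 1 * cf_mat 1 \<preceq> seq_prod (\<lambda>i. cf_mat (c i)) a b"
proof -
  have "Suc a < b" using assms(2,3) by (cases "b = Suc a") auto
  then have "cf_mat 1 \<preceq> seq_prod (\<lambda>i. cf_mat (c i)) (Suc a) b"
    using assms by (intro seq_prod_cf_mat_odd) auto
  then have "cf_mat 1 * cf_mat 1 \<preceq> cf_mat (c a) * seq_prod (\<lambda>i. cf_mat (c i)) (Suc a) b"
    using assms(1)[of a] by (intro entrywise_le_mult) (auto simp: cf_mat_def)
  with \<open>a < b\<close> show ?thesis by (simp add: seq_prod_Cons)
qed

text \<open>The trace of \<open>cf_mat (c 0) * R\<close> is \<open>c 0 * x + y + z\<close>, where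
  \<open>R\<close> has top row \<open>x, y\<close> and lower left entry \<open>z\<close>. The
  remaining \<open>2 * n - 1\<close> factors are odd in number, so \<open>x\<close> is at least 1
  and the strict gap in the first digit survives.\<close>

lemma tr2_seq_prod_cf_mat_strict_mono:
  assumes "\<And>i. 1 \<le> c i" "\<And>i. c i \<le> c' i" "c 0 < c' 0" "0 < n"
  shows "tr2 (seq_prod (\<lambda>i. cf_mat (c i)) 0 (2 * n)) < tr2 (seq_prod (\<lambda>i. cf_mat (c' i)) 0 (2 * n))"
proof -
  let ?R = "seq_prod (\<lambda>i. cf_mat (c i)) (Suc 0) (2 * n)"
  let ?R' = "seq_prod (\<lambda>i. cf_mat (c' i)) (Suc 0) (2 * n)"
  have R: "cf_mat 1 \<preceq> ?R"
    using assms by (intro seq_prod_cf_mat_odd) auto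
  have RR: "?R \<preceq> ?R'"
    using assms by (intro seq_prod_cf_mat_mono[THEN conjunct2]) (auto intro: order_trans[OF zero_le_one])
  obtain x y z w where R_eq: "?R = Mat2 x y z w" by (cases ?R)
  obtain x' y' z' w' where R'_eq: "?R' = Mat2 x' y' z' w'" by (cases ?R')
  have le: "1 \<le> x" "x \<le> x'" "y \<le> y'" "z \<le> z'"
    using R[unfolded R_eq] RR[unfolded R_eq R'_eq] by (auto simp: cf_mat_def)
  have "c 0 * x < c' 0 * x'"
    using le assms(1)[of 0] assms(3) by (intro mult_less_le_imp_less) auto
  moreover have "seq_prod (\<lambda>i. cf_mat (c i)) 0 (2 * n) = cf_mat (c 0) * ?R"
    "seq_prod (\<lambda>i. cf_mat (c' i)) 0 (2 * n) = cf_mat (c' 0) * ?R'"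
    using \<open>0 < n\<close> by (simp_all only: seq_prod_Cons[of 0] mult_pos_pos zero_less_numeral)
  ultimately show ?thesis
    using le by (simp add: R_eq R'_eq) (simp add: cf_mat_def)
qed

text \<open>The inner factor \<open>Q\<close> is bounded below by the identity, the outer one by the
  square of \<open>cf_mat 1\<close>, and the latter alone already raises the trace.\<close>

lemma tr2_square_strict_mono:
  assumes P: "cf_mat 1 \<preceq> P" and Q: "cf_mat 1 * cf_mat 1 \<preceq> Q"
  shows "tr2 (P * P) < tr2 ((P * Q) * (P * Q))"
proof -
  let ?E = "Mat2 1 1 1 0"
  have pos: "zero2 \<preceq> P" and posQ: "zero2 \<preceq> Q"
    using P Q by (cases P; cases Q; simp add: cf_mat_def)+
  have PP: "zero2 * zero2 \<preceq> P * P" by (intro entrywise_le_mult) (use pos in simp_all)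
  have "P * P * (cf_mat 1 * cf_mat 1) \<preceq> P * (Q * (P * Q))"
  proof -
    have "P * P \<preceq> P * (Q * P)"
    proof (rule entrywise_le_mult[OF entrywise_le_refl _ pos pos])
      have "1 * P \<preceq> Q * P"
        using Q posQ pos by (intro entrywise_le_mult)
          (cases Q; simp add: one_mat2_def cf_mat_def entrywise_le_refl)+
      then show "P \<preceq> Q * P" by simp
    qed
    then have "P * P * (cf_mat 1 * cf_mat 1) \<preceq> P * (Q * P) * Q"
      by (rule entrywise_le_mult) (use Q PP in \<open>simp_all add: cf_mat_def\<close>)
    then show ?thesis by (simp add: mult.assoc)
  qed
  moreover have "tr2 (P * P) < tr2 (P * P * (cf_mat 1 * cf_mat 1))"
  proof -
    \<comment> \<open>Writing a, b, c, d for the entries of \<open>P * P\<close>, the right-hand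
      trace is 2a + b + c + d, and a is positive.\<close>
    have "cf_mat 1 * cf_mat 1 \<preceq> P * P"
      using P by (intro entrywise_le_mult) (simp_all add: cf_mat_def)
    then show ?thesis
      by (cases "P * P") (simp add: cf_mat_def)
  qed
  ultimately show ?thesis
    using tr2_mono by (fastforce simp: mult.assoc)
qed

section \<open>Matrices of braids and dilatation\<close>

fun letter_mat2 :: "gen \<times> bool \<Rightarrow> mat2" where
  "letter_mat2 (S1, True) = Mat2 1 0 (- 1) 1"
| "letter_mat2 (S1, False) = Mat2 1 0 1 1"
| "letter_mat2 (S2, True) = Mat2 1 1 0 1"
| "letter_mat2 (S2, False) = Mat2 1 (- 1) 0 1"

definition word_mat2 :: "word \<Rightarrow> mat2" where
  "word_mat2 w = prod_list (map letter_mat2 w)"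

fun to_mat :: "mat2 \<Rightarrow> int mat" where
  "to_mat (Mat2 a b c d) = mat_of_rows_list 2 [[a, b], [c, d]]"

text \<open>A braid determines its matrix only up to sign. Asking for some representing word makes
  the relation multiplicative by concatenation of words.\<close>

definition represents :: "braid3 \<Rightarrow> mat2 \<Rightarrow> bool" where
  "represents x P \<longleftrightarrow> (\<exists>w. x = abs_braid3 w \<and> (word_mat2 w = P \<or> word_mat2 w = - P))"

lemma to_mat_carrier [simp]: "to_mat P \<in> carrier_mat 2 2"
  by (cases P) (simp add: mat_of_rows_list_def numeral_2_eq_2)

lemma to_mat_mult: "to_mat (P * Q) = to_mat P * to_mat Q"
  by (cases P; cases Q)
    (rule mat2_eqI; (rule mult_carrier_mat[OF to_mat_carrier to_mat_carrier] to_mat_carrier)?;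
     simp add: mat2_eval)

lemma to_mat_uminus: "to_mat (- P) = - to_mat P"
  by (cases P)
    (rule mat2_eqI; (rule uminus_carrier_mat[OF to_mat_carrier] to_mat_carrier)?;
     simp add: mat2_eval)

lemma word_matrix_eq_to_mat: "word_matrix w = to_mat (word_mat2 w)"
proof (induction w)
  case Nil
  show ?case
    by (rule mat2_eqI; (rule to_mat_carrier word_matrix_carrier)?;
      simp add: word_mat2_def one_mat2_def mat2_eval)
next
  case (Cons x w)
  have "letter_matrix x = to_mat (letter_mat2 x)"
    by (cases x rule: letter_mat2.cases) simp_all
  with Cons show ?case by (simp add: word_mat2_def to_mat_mult)
qed

lemma word_mat2_append: "word_mat2 (u @ v) = word_mat2 u * word_mat2 v"
  by (simp add: word_mat2_def)

lemma det2_word_mat2: "det2 (word_mat2 w) = 1"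
proof (induction w)
  case (Cons x w)
  have "det2 (letter_mat2 x) = 1"
    by (cases x rule: letter_mat2.cases) simp_all
  with Cons show ?case by (simp add: word_mat2_def det2_mult)
qed (simp add: word_mat2_def one_mat2_def)

lemma word_mat2_inverse: "word_mat2 (word_inverse w) = adj2 (word_mat2 w)"
proof (induction w)
  case (Cons x w)
  obtain g e where x: "x = (g, e)" by (cases x)
  have "word_mat2 [(g, \<not> e)] = adj2 (letter_mat2 x)"
    by (cases x rule: letter_mat2.cases) (simp_all add: word_mat2_def x)
  moreover have "word_inverse (x # w) = word_inverse w @ [(g, \<not> e)]"
    by (simp add: x word_inverse_def)
  ultimately show ?case
    using Cons by (simp only: word_mat2_append) (simp add: word_mat2_def adj2_mult)
qed (simp add: word_inverse_def word_mat2_def one_mat2_def)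

lemma represents_mult: "represents x P \<Longrightarrow> represents y Q \<Longrightarrow> represents (x * y) (P * Q)"
  unfolding represents_def
  by (metis times_braid3.abs_eq word_mat2_append mat2_mult_uminus)

lemma represents_one: "represents 1 1"
  unfolding represents_def by (metis one_braid3.abs_eq word_mat2_def list.map(1) prod_list.Nil)

lemma represents_inverse: "represents x P \<Longrightarrow> represents (inverse x) (adj2 P)"
  unfolding represents_def by (metis inverse_braid3.abs_eq word_mat2_inverse adj2_uminus)

lemma represents_prod_list:
  "(\<And>k. k \<in> set ks \<Longrightarrow> represents (f k) (g k)) \<Longrightarrow>
    represents (prod_list (map f ks)) (prod_list (map g ks))"
  by (induction ks) (simp_all add: represents_one represents_mult)

lemma represents_conj_class:
  assumes "y \<in> conj_class x" "represents x P"
  shows "\<exists>Q. represents y Q \<and> tr2 Q = tr2 P"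
proof -
  obtain g where y: "y = g * x * inverse g" using assms(1) by (auto simp: conj_class_def)
  have "\<exists>w. g = abs_braid3 w" by (induction g rule: braid3.abs_induct) blast
  then obtain w where g: "g = abs_braid3 w" ..
  have "represents g (word_mat2 w)" unfolding represents_def g by blast
  then have "represents y (word_mat2 w * P * adj2 (word_mat2 w))"
    unfolding y by (intro represents_mult represents_inverse assms(2))
  then show ?thesis using tr2_conj[OF det2_word_mat2] by blast
qed

section \<open>The spectral radius as a function of the trace\<close>

lemma det_mat_2:
  fixes A :: "'a :: comm_ring_1 mat"
  assumes A: "A \<in> carrier_mat 2 2"
  shows "det A = A $$ (0, 0) * A $$ (1, 1) - A $$ (0, 1) * A $$ (1, 0)"
proof -
  have "mat_delete A 0 j \<in> carrier_mat 1 1" for j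
    using mat_delete_carrier[OF A, of 0 j] by simp
  then show ?thesis
    using A unfolding laplace_expansion_row[OF A, of 0, simplified]
    by (simp add: numeral_2_eq_2 cofactor_def det_single mat_delete_def)
qed

text \<open>The larger root of \<open>x^2 - t * x + 1\<close>.\<close>

definition dil_of_trace :: "int \<Rightarrow> real" where
  "dil_of_trace t = (of_int t + sqrt ((of_int t)\<^sup>2 - 4)) / 2"

lemma dil_of_trace_strict_mono: "2 \<le> s \<Longrightarrow> s < t \<Longrightarrow> dil_of_trace s < dil_of_trace t"
  unfolding dil_of_trace_def
  by (intro divide_strict_right_mono add_less_le_mono real_sqrt_le_mono diff_right_mono power_mono)
    auto

text \<open>With determinant 1 the characteristic polynomial is \<open>k^2 - t * k + 1\<close>;
  trace at least 2 makes both roots real and nonnegative, so the larger one is the spectral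
  radius.\<close>

lemma spectral_radius_to_mat:
  assumes "det2 P = 1" "2 \<le> tr2 P"
  shows "spectral_radius (map_mat of_int (to_mat P)) = dil_of_trace (tr2 P)"
proof -
  obtain a b c d where P: "P = Mat2 a b c d" by (cases P)
  let ?A = "map_mat complex_of_int (to_mat P)"
  define t where "t = real_of_int (tr2 P)"
  define s where "s = sqrt (t\<^sup>2 - 4)"
  have t: "2 \<le> t" using assms by (simp add: t_def)
  then have s: "0 \<le> s" "s\<^sup>2 = t\<^sup>2 - 4" "s \<le> t"
    using power_mono[of 2 t 2] by (auto simp: s_def intro: real_le_lsqrt)
  have A: "?A \<in> carrier_mat 2 2" by simp
  have entries: "?A $$ (0, 0) = of_int a" "?A $$ (0, 1) = of_int b"
    "?A $$ (1, 0) = of_int c" "?A $$ (1, 1) = of_int d"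
    by (simp_all add: P mat2_eval)
  have tr: "complex_of_int a + of_int d = of_real t"
    by (simp add: t_def P)
  have det: "complex_of_int a * of_int d - of_int b * of_int c = 1"
    using assms(1) by (metis P det2.simps of_int_1 of_int_diff of_int_mult)
  have "eigenvalue ?A k \<longleftrightarrow> k = of_real ((t + s) / 2) \<or> k = of_real ((t - s) / 2)" for k
  proof -
    have cm: "char_matrix ?A k \<in> carrier_mat 2 2"
      by (rule char_matrix_closed[OF A])
    have "eigenvalue ?A k \<longleftrightarrow> (of_int a - k) * (of_int d - k) - of_int b * of_int c = 0"
      unfolding eigenvalue_det[OF A] det_mat_2[OF cm]
      using entries carrier_matD[OF to_mat_carrier[of P]] by (simp add: char_matrix_def)
    also have "(of_int a - k) * (of_int d - k) - of_int b * of_int c = k\<^sup>2 - of_real t * k + 1"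
      unfolding tr[symmetric] det[symmetric] by (simp add: algebra_simps power2_eq_square)
    also have "\<dots> = (k - of_real ((t + s) / 2)) * (k - of_real ((t - s) / 2))"
    proof -
      have "(t + s) / 2 * ((t - s) / 2) = 1"
        using s(2) by (simp add: field_simps power2_eq_square)
      then have prod: "complex_of_real ((t + s) / 2) * of_real ((t - s) / 2) = 1"
        by (metis of_real_1 of_real_mult)
      have sum: "complex_of_real ((t + s) / 2) + of_real ((t - s) / 2) = of_real t"
        by (simp only: of_real_add[symmetric] flip: add_divide_distrib) simp
      have "k\<^sup>2 - (u + v) * k + u * v = (k - u) * (k - v)" for u v :: complex
        by (simp add: algebra_simps power2_eq_square)
      from this[of "of_real ((t + s) / 2)" "of_real ((t - s) / 2)"] show ?thesis
        unfolding prod sum .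
    qed
    finally show ?thesis by simp
  qed
  then have "spectrum ?A = {of_real ((t + s) / 2), of_real ((t - s) / 2)}"
    unfolding spectrum_def by blast
  moreover have "norm (complex_of_real ((t + s) / 2)) = (t + s) / 2"
    "norm (complex_of_real ((t - s) / 2)) = (t - s) / 2"
    using s t by (simp_all only: norm_of_real) simp_all
  ultimately have "spectral_radius ?A = max ((t + s) / 2) ((t - s) / 2)"
    by (simp only: spectral_radius_def image_insert image_empty) simp
  then show ?thesis
    using s by (simp add: dil_of_trace_def t_def[symmetric] s_def[symmetric])
qed

lemma dilatation_represents:
  assumes "represents x P" "2 \<le> tr2 P"
  shows "dilatation x = dil_of_trace (tr2 P)"
proof -
  obtain w where x: "x = abs_braid3 w" and w: "word_mat2 w = P \<or> word_mat2 w = - P"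
    using assms(1) by (auto simp: represents_def)
  have det: "det2 P = 1" using det2_word_mat2[of w] w by (auto simp: det2_uminus)
  have "map_mat complex_of_int (- to_mat P) = - map_mat complex_of_int (to_mat P)"
    by (intro eq_matI) auto
  then have "spectral_radius (map_mat complex_of_int (to_mat (- P))) =
      spectral_radius (map_mat complex_of_int (to_mat P))"
    using spectral_radius_uminus[of "map_mat complex_of_int (to_mat P)" 2]
    by (simp add: to_mat_uminus)
  then show ?thesis
    using w spectral_radius_to_mat[OF det assms(2)]
    by (auto simp: x dilatation.abs_eq word_matrix_eq_to_mat)
qed

section \<open>The cutting sequence\<close>

text \<open>Offset 0 gives the floor of \<open>q * i / n\<close>; for odd \<open>n\<close> the
  offset \<open>(n - 1) div 2\<close> gives rounding to the nearest integer, without ties.\<close>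

definition height :: "int \<Rightarrow> int \<Rightarrow> int \<Rightarrow> nat \<Rightarrow> int" where
  "height h q n i = (q * int i + h) div n"

definition cf_digit :: "int \<Rightarrow> int \<Rightarrow> int \<Rightarrow> int \<Rightarrow> nat \<Rightarrow> int" where
  "cf_digit N h q n i = 2 * N - 1 + 2 * (height h q n (Suc i) - height h q n i)"

text \<open>Up to sign, the matrix of one factor \<open>A powi ((\<epsilon> - \<epsilon>') div 2) *
  B powi \<epsilon>'\<close> of the word, where even and odd arguments stand for the exponents -1
  and 1.\<close>

definition turn :: "int \<Rightarrow> int \<Rightarrow> mat2" where
  "turn e e' =
    (if even e then if even e' then Mat2 0 (- 1) 1 1 else Mat2 1 0 1 1
     else if even e' then Mat2 1 1 0 1 else Mat2 1 1 (- 1) 0)"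

definition shear :: "int \<Rightarrow> int \<Rightarrow> mat2" where
  "shear e c = (if even e then Mat2 1 c 0 1 else Mat2 1 0 c 1)"

lemma height_mono: "0 \<le> q \<Longrightarrow> 0 < n \<Longrightarrow> height h q n i \<le> height h q n (Suc i)"
  unfolding height_def by (intro zdiv_mono1) (simp_all add: distrib_left)

lemma height_bounds:
  assumes "0 < n"
  shows "height h q n i * n \<le> q * int i + h" "q * int i + h < (height h q n i + 1) * n"
proof -
  define a where "a = q * int i + h"
  have "a = a div n * n + a mod n" "0 \<le> a mod n" "a mod n < n" using assms by simp_all
  then have "a div n * n \<le> a" "a < (a div n + 1) * n" unfolding distrib_right by linarith+
  then show "height h q n i * n \<le> q * int i + h" "q * int i + h < (height h q n i + 1) * n"
    by (simp_all only: height_def a_def)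
qed

lemma cf_digit_ge_1: "1 \<le> N \<Longrightarrow> 0 \<le> q \<Longrightarrow> 0 < n \<Longrightarrow> 1 \<le> cf_digit N h q n i"
  using height_mono[of q n h i] by (simp add: cf_digit_def)

text \<open>A digit matrix times the swap of coordinates is an upper shear, and the swap times a
  digit matrix is a lower one; in a pair the two swaps cancel.\<close>

lemma seq_prod_shear_pairs:
  "seq_prod (\<lambda>i. shear (int i) (c i)) 0 (2 * k) = seq_prod (\<lambda>i. cf_mat (c i)) 0 (2 * k)"
proof (induction k)
  case (Suc k)
  have "shear (int (2 * k)) (c (2 * k)) * shear (int (Suc (2 * k))) (c (Suc (2 * k))) =
      cf_mat (c (2 * k)) * cf_mat (c (Suc (2 * k)))"
    by (simp add: shear_def cf_mat_def)
  with Suc show ?case by (simp add: seq_prod_Suc mult.assoc)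
qed simp

text \<open>The parities in a block repeat with period 3. The first turn is
  \<open>shear s 1\<close>, and each further triple multiplies to \<open>shear s 2\<close> exactly,
  without a sign.\<close>

lemma seq_prod_turn_block:
  "seq_prod (\<lambda>x. turn (s + (2 * int x - 1) div 3) (s + (2 * int x + 1) div 3)) 0 (3 * r + 1) =
    shear s (2 * int r + 1)"
proof (induction r)
  case 0
  show ?case by (simp add: seq_prod_Suc turn_def shear_def)
next
  case (Suc r)
  have *: "(2 * int (3 * r + 1) - 1) div 3 = 2 * int r" "(2 * int (3 * r + 1) + 1) div 3 = 2 * int r + 1"
    "(2 * int (3 * r + 2) - 1) div 3 = 2 * int r + 1" "(2 * int (3 * r + 2) + 1) div 3 = 2 * int r + 1"
    "(2 * int (3 * r + 3) - 1) div 3 = 2 * int r + 1" "(2 * int (3 * r + 3) + 1) div 3 = 2 * int r + 2"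
    by simp_all
  have "3 * Suc r + 1 = Suc (Suc (Suc (3 * r + 1)))" by simp
  then have "seq_prod (\<lambda>x. turn (s + (2 * int x - 1) div 3) (s + (2 * int x + 1) div 3))
      0 (3 * Suc r + 1) =
    shear s (2 * int r + 1) * turn (s + 2 * int r) (s + (2 * int r + 1)) *
      turn (s + (2 * int r + 1)) (s + (2 * int r + 1)) * turn (s + (2 * int r + 1)) (s + (2 * int r + 2))"
    using * by (simp only: seq_prod_Suc Suc.IH le0) (simp add: numeral_3_eq_3 numeral_2_eq_2 algebra_simps)
  also have "\<dots> = shear s (2 * int (Suc r) + 1)"
    by (cases "even s") (simp_all add: turn_def shear_def)
  finally show ?case .
qed

text \<open>The deviation \<open>g n - q i\<close> measures how far \<open>g\<close> is from \<open>q i / n\<close>; rounding keeps it between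
  \<open>- n / 2\<close> and \<open>n / 2\<close>, which confines each block of the cutting sequence.\<close>

lemma cutting_height:
  fixes N n q l M g i x \<delta> :: int
  assumes "1 \<le> N" "0 < n" "0 \<le> q"
    and l: "l = (2 * N - 1) * n + 2 * q" and M: "M = (3 * N - 2) * n + 3 * q"
    and dev: "- n < 2 * (g * n - q * i)" "2 * (g * n - q * i) < n"
      "2 * ((g + \<delta>) * n - q * (i + 1)) < n"
    and x: "- 1 \<le> x" "x \<le> 3 * (N + \<delta>) - 3"
  shows "(l * (2 * ((3 * N - 2) * i + 3 * g + 1 + x) - 1)) div (2 * M) =
    (2 * N - 1) * i + 2 * g + (2 * x + 1) div 3"
proof -
  define d where "d = g * n - q * i"
  have "3 * l - 2 * M = n" by (simp add: l M algebra_simps)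
  \<comment> \<open>Twice this identity splits the numerator into \<open>2 * M\<close> times
    \<open>(2 * N - 1) * i + 2 * g\<close> plus \<open>2 * d + l * (2 * x + 1)\<close>; only the
    latter is left to divide.\<close>
  have key: "l * ((3 * N - 2) * i + 3 * g) - M * ((2 * N - 1) * i + 2 * g) = d"
    by (simp add: l M d_def algebra_simps)
  have d: "- n < 2 * d" "2 * d < n" "2 * d + 2 * (\<delta> * n) < n + 2 * q"
    using dev by (simp_all add: d_def algebra_simps)
  have Nn: "n \<le> N * n" using assms(1,2) by simp
  have l': "l = 2 * (N * n) - n + 2 * q" and M': "M = 3 * (N * n) - 2 * n + 3 * q"
    by (simp_all add: l M algebra_simps)
  have yn: "0 \<le> y * n" if "0 \<le> y" for y using that assms(2) by simp
  have yn_le: "y * n \<le> N * n + \<delta> * n - j * n" if "y \<le> N + \<delta> - j" for y j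
    using mult_right_mono[OF that, of n] assms(2) by (simp add: algebra_simps)
  have divI: "(l * (2 * ((3 * N - 2) * i + 3 * g + 1 + x) - 1)) div (2 * M) = (2 * N - 1) * i + 2 * g + f"
    if "2 * d + l * (2 * x + 1) = 2 * M * f + r" "0 \<le> r" "r < 2 * M" for f r
  proof (rule int_div_pos_eq[OF _ that(2,3)])
    show "l * (2 * ((3 * N - 2) * i + 3 * g + 1 + x) - 1) = 2 * M * ((2 * N - 1) * i + 2 * g + f) + r"
      using key that(1) by (simp add: algebra_simps)
  qed
  \<comment> \<open>In each residue class of \<open>x\<close> modulo 3 the quotient is explicit, and
    the deviation bounds keep the remainder between 0 and \<open>2 * M\<close>; the bound on the
    next deviation serves the end of the block.\<close>
  consider y where "x = 3 * y - 1" | y where "x = 3 * y" | y where "x = 3 * y + 1"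
  proof -
    have "\<exists>y. x = 3 * y - 1 \<or> x = 3 * y \<or> x = 3 * y + 1" by presburger
    then show ?thesis using that by blast
  qed
  then show ?thesis
  proof cases
    case 1
    then have y: "0 \<le> y" "y \<le> N + \<delta> - 1" "(2 * x + 1) div 3 = 2 * y - 1" using x by auto
    have "2 * d + l * (2 * x + 1) = 2 * M * (2 * y - 1) + (2 * d + 2 * (y * n) + 2 * l - n)"
      unfolding 1 \<open>3 * l - 2 * M = n\<close>[symmetric] by (simp add: algebra_simps)
    moreover have "0 \<le> 2 * d + 2 * (y * n) + 2 * l - n"
      using d Nn yn[OF y(1)] assms(2,3) l' M' by linarith
    moreover have "2 * d + 2 * (y * n) + 2 * l - n < 2 * M"
      using d Nn yn_le[OF y(2)] assms(2,3) l' M' by linarith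
    ultimately show ?thesis unfolding y(3) by (rule divI)
  next
    case 2
    then have y: "0 \<le> y" "y \<le> N + \<delta> - 1" "(2 * x + 1) div 3 = 2 * y" using x by auto
    have "2 * d + l * (2 * x + 1) = 2 * M * (2 * y) + (2 * d + 2 * (y * n) + l)"
      unfolding 2 \<open>3 * l - 2 * M = n\<close>[symmetric] by (simp add: algebra_simps)
    moreover have "0 \<le> 2 * d + 2 * (y * n) + l"
      using d Nn yn[OF y(1)] assms(2,3) l' M' by linarith
    moreover have "2 * d + 2 * (y * n) + l < 2 * M"
      using d Nn yn_le[OF y(2)] assms(2,3) l' M' by linarith
    ultimately show ?thesis unfolding y(3) by (rule divI)
  next
    case 3
    then have y: "0 \<le> y" "y \<le> N + \<delta> - 2" "(2 * x + 1) div 3 = 2 * y + 1" using x by auto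
    have "2 * d + l * (2 * x + 1) = 2 * M * (2 * y + 1) + (2 * d + 2 * (y * n) + n)"
      unfolding 3 \<open>3 * l - 2 * M = n\<close>[symmetric] by (simp add: algebra_simps)
    moreover have "0 \<le> 2 * d + 2 * (y * n) + n"
      using d Nn yn[OF y(1)] assms(2,3) l' M' by linarith
    moreover have "2 * d + 2 * (y * n) + n < 2 * M"
      using d Nn yn_le[OF y(2)] assms(2,3) l' M' by linarith
    ultimately show ?thesis unfolding y(3) by (rule divI)
  qed
qed

text \<open>The indices are cut at \<open>T i\<close>. Each block of turns collapses to one shear,
  alternately upper and lower, and consecutive shears pair up to digit matrices.\<close>

lemma seq_prod_cutting_sequence:
  fixes N n q l M :: int
  assumes N: "1 \<le> N" and n: "0 < n" "odd n" and q: "0 \<le> q"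
    and l: "l = (2 * N - 1) * n + 2 * q" and M: "M = (3 * N - 2) * n + 3 * q"
  shows "seq_prod (\<lambda>k. turn ((l * (2 * int k - 1)) div (2 * M)) ((l * (2 * int k + 1)) div (2 * M)))
      0 (2 * nat M) =
    seq_prod (\<lambda>i. cf_mat (cf_digit N ((n - 1) div 2) q n i)) 0 (2 * nat n)"
proof -
  define h where "h = (n - 1) div 2"
  have h: "2 * h = n - 1" using n(2) by (simp add: h_def)
  define g where "g = height h q n"
  define T where "T i = nat ((3 * N - 2) * int i + 3 * g i)" for i
  define f where "f k = turn ((l * (2 * int k - 1)) div (2 * M)) ((l * (2 * int k + 1)) div (2 * M))" for k
  have g_mono: "g i \<le> g (Suc i)" for i
    unfolding g_def by (rule height_mono[OF q n(1)])
  have g0: "g 0 = 0" using h n(1) by (simp add: g_def height_def)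
  have g_nonneg: "0 \<le> g i" for i
    using h n(1) q by (simp add: g_def height_def pos_imp_zdiv_nonneg_iff)
  \<comment> \<open>Since \<open>n\<close> is odd, rounding meets no ties and both bounds are
    strict.\<close>
  have dev: "- n < 2 * (g i * n - q * int i)" "2 * (g i * n - q * int i) < n" for i
  proof -
    note b = height_bounds[OF n(1), where h = h and q = q and i = i, folded g_def, unfolded distrib_right]
    show "- n < 2 * (g i * n - q * int i)" using h b unfolding right_diff_distrib by linarith
    show "2 * (g i * n - q * int i) < n" using h b unfolding right_diff_distrib by linarith
  qed
  have int_T: "int (T i) = (3 * N - 2) * int i + 3 * g i" for i
    using N g_nonneg by (simp add: T_def)
  have T_0: "T 0 = 0" by (simp add: T_def g0)
  have T_Suc: "T (Suc i) = (3 * nat (N - 1 + (g (Suc i) - g i)) + 1) + T i" for i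
  proof -
    have "int (T (Suc i)) = int ((3 * nat (N - 1 + (g (Suc i) - g i)) + 1) + T i)"
      using N g_mono[of i] by (simp add: int_T algebra_simps)
    then show ?thesis by (simp only: of_nat_eq_iff)
  qed
  then have "mono T" by (intro mono_iff_le_Suc[THEN iffD2]) simp
  have "g (2 * nat n) = 2 * q"
  proof -
    have "g (2 * nat n) = (h + (2 * q) * n) div n"
      using n(1) by (simp add: g_def height_def algebra_simps)
    also have "\<dots> = 2 * q" using h n(1) by (subst div_mult_self1) auto
    finally show ?thesis .
  qed
  then have "int (T (2 * nat n)) = 2 * M" using n(1) by (simp add: int_T M algebra_simps)
  then have T_end: "T (2 * nat n) = 2 * nat M" by simp
  have block: "seq_prod f (T i) (T (Suc i)) = shear (int i) (cf_digit N h q n i)" for i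
  proof -
    define r where "r = nat (N - 1 + (g (Suc i) - g i))"
    have r: "int r = N - 1 + (g (Suc i) - g i)" using N g_mono[of i] by (simp add: r_def)
    \<comment> \<open>As \<open>2 * N - 1\<close> is odd, \<open>s\<close> has the parity of
      \<open>i\<close>, so the shears alternate.\<close>
    define s where "s = (2 * N - 1) * int i + 2 * g i"
    \<comment> \<open>Turn \<open>x\<close> of a block involves the exponents at
      \<open>x - 1\<close> and \<open>x\<close>, so the range starts one place before the
      block.\<close>
    have E: "(l * (2 * (int (T i) + 1 + x) - 1)) div (2 * M) = s + (2 * x + 1) div 3"
      if "- 1 \<le> x" "x \<le> 3 * int r" for x
      unfolding int_T s_def
      by (rule cutting_height[OF N n(1) q l M dev, where \<delta> = "g (Suc i) - g i"])
        (use dev(2)[of "Suc i"] that r in \<open>simp_all add: algebra_simps\<close>)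
    have "seq_prod f (T i) (T (Suc i)) = seq_prod (\<lambda>x. f (x + T i)) 0 (3 * r + 1)"
      using seq_prod_shift[of f 0 "T i" "3 * r + 1"] by (simp add: T_Suc r_def)
    also have "\<dots> = seq_prod (\<lambda>x. turn (s + (2 * int x - 1) div 3) (s + (2 * int x + 1) div 3))
        0 (3 * r + 1)"
    proof (rule seq_prod_cong)
      fix x assume "x < 3 * r + 1"
      then show "f (x + T i) = turn (s + (2 * int x - 1) div 3) (s + (2 * int x + 1) div 3)"
        using E[of "int x - 1"] E[of "int x"] by (simp add: f_def algebra_simps)
    qed
    also have "\<dots> = shear s (2 * int r + 1)" by (rule seq_prod_turn_block)
    also have "\<dots> = shear (int i) (cf_digit N h q n i)"
      by (simp add: shear_def s_def r cf_digit_def g_def algebra_simps)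
    finally show ?thesis .
  qed
  have "seq_prod f 0 (2 * nat M) = seq_prod (\<lambda>i. shear (int i) (cf_digit N h q n i)) 0 (2 * nat n)"
    using seq_prod_regroup[OF \<open>mono T\<close> T_0, of f "2 * nat n"] unfolding T_end block .
  then show ?thesis
    unfolding seq_prod_shear_pairs h_def f_def[abs_def] .
qed

section \<open>The trace of a Lissajous word\<close>

lemma represents_generators:
  "represents \<sigma>1 (Mat2 1 0 (- 1) 1)" "represents \<sigma>2 (Mat2 1 1 0 1)"
  unfolding represents_def \<sigma>1.abs_eq \<sigma>2.abs_eq by (force simp: word_mat2_def)+

lemma represents_A: "represents (\<sigma>1 * \<sigma>2 * \<sigma>1) (Mat2 0 1 (- 1) 0)"
  using represents_mult[OF represents_mult[OF represents_generators] represents_generators(1)] by simp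

lemma represents_B: "represents (\<sigma>1 * \<sigma>2) (Mat2 1 1 (- 1) 0)"
  using represents_mult[OF represents_generators] by simp

definition exponent_sign :: "int \<Rightarrow> int" where "exponent_sign e = 2 * (e mod 2) - 1"

lemma represents_turn:
  "represents ((\<sigma>1 * \<sigma>2 * \<sigma>1) powi ((exponent_sign e - exponent_sign e') div 2) *
    (\<sigma>1 * \<sigma>2) powi (exponent_sign e')) (turn e e')"
proof -
  note A = represents_A and B = represents_B
  note A' = represents_inverse[OF A] and B' = represents_inverse[OF B]
  consider "even e" "even e'" | "even e" "odd e'" | "odd e" "even e'" | "odd e" "odd e'" by blast
  then show ?thesis
  proof cases
    case 1
    then show ?thesis
      using B' by (simp add: exponent_sign_def turn_def mod2_eq_if power_int_def)
  next
    case 2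
    then show ?thesis
      using represents_mult[OF A' B]
      by (simp add: exponent_sign_def turn_def mod2_eq_if power_int_def)
  next
    case 3
    then show ?thesis
      using represents_mult[OF A B']
      by (simp add: exponent_sign_def turn_def mod2_eq_if power_int_def)
  next
    case 4
    then show ?thesis
      using B by (simp add: exponent_sign_def turn_def mod2_eq_if power_int_def)
  qed
qed

text \<open>As \<open>m\<close> and \<open>n\<close> have opposite signs, \<open>m - n\<close> has
  the sign of \<open>m\<close> and absolute value \<open>\<bar>m\<bar> + \<bar>n\<bar>\<close>;
  bounds on \<open>\<bar>n\<bar>\<close> become bounds on
  \<open>\<bar>ell m n\<bar>\<close>.\<close>

lemma P0_facts:
  assumes "(m, n) \<in> P0"
  shows "m - n = 3 * ell m n" "0 < m * ell m n" "\<bar>n\<bar> = 3 * \<bar>ell m n\<bar> - \<bar>m\<bar>" "0 < \<bar>m\<bar>"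
    "0 < \<bar>ell m n\<bar>" "\<bar>ell m n\<bar> \<le> \<bar>m\<bar>" "2 * \<bar>m\<bar> < 3 * \<bar>ell m n\<bar>" "coprime \<bar>ell m n\<bar> \<bar>m\<bar>"
proof -
  have mn: "coprime m n" "m * n < 0" "\<bar>m\<bar> < \<bar>n\<bar>" "\<bar>n\<bar> \<le> 2 * \<bar>m\<bar>" and "[m = n] (mod 3)"
    using assms by (auto simp: P0_def intro: cong_trans cong_sym)
  then show ell: "m - n = 3 * ell m n"
    by (simp add: ell_def cong_iff_dvd_diff)
  have signs: "0 < m \<and> n < 0 \<or> m < 0 \<and> 0 < n" using mn(2) by (simp add: mult_less_0_iff)
  then show "0 < m * ell m n" "\<bar>n\<bar> = 3 * \<bar>ell m n\<bar> - \<bar>m\<bar>" "0 < \<bar>m\<bar>" "0 < \<bar>ell m n\<bar>"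
    using ell by (auto simp: zero_less_mult_iff)
  then show "\<bar>ell m n\<bar> \<le> \<bar>m\<bar>" "2 * \<bar>m\<bar> < 3 * \<bar>ell m n\<bar>" using mn(3,4) by linarith+
  have "coprime (ell m n) m"
  proof (rule coprimeI)
    fix c assume c: "c dvd ell m n" "c dvd m"
    then have "c dvd m - 3 * ell m n" by (intro dvd_diff dvd_mult) auto
    moreover have "m - 3 * ell m n = n" using ell by simp
    ultimately have "c dvd n" by simp
    with c(2) mn(1) show "is_unit c" by (meson coprime_common_divisor)
  qed
  then show "coprime \<bar>ell m n\<bar> \<bar>m\<bar>" by simp
qed

lemma eps_eq_exponent_sign:
  assumes "(m, n) \<in> P0"
  shows "eps m n k = exponent_sign ((\<bar>ell m n\<bar> * (2 * k - 1)) div (2 * \<bar>m\<bar>))"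
proof -
  note P0 = P0_facts[OF assms]
  have "real_of_int \<bar>ell m n\<bar> / real_of_int \<bar>m\<bar> * real_of_int k -
      real_of_int \<bar>ell m n\<bar> / (2 * real_of_int \<bar>m\<bar>) =
      real_of_int (\<bar>ell m n\<bar> * (2 * k - 1)) / real_of_int (2 * \<bar>m\<bar>)"
    using P0(4) by (simp add: field_simps)
  then have "\<lfloor>real_of_int \<bar>ell m n\<bar> / real_of_int \<bar>m\<bar> * real_of_int k -
      real_of_int \<bar>ell m n\<bar> / (2 * real_of_int \<bar>m\<bar>)\<rfloor> = (\<bar>ell m n\<bar> * (2 * k - 1)) div (2 * \<bar>m\<bar>)"
    by (simp only: floor_divide_of_int_eq)
  then show ?thesis
    unfolding eps_def Let_def exponent_sign_def by (simp only: sgn_pos[OF P0(2)] mult_1)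
qed

text \<open>The two boundary powers contribute exactly one \<open>A\<close>, in front if
  \<open>m\<close> is positive and at the end otherwise. Cyclically it precedes the first factor
  \<open>inverse B\<close>, and together they form the turn at index 0.\<close>

lemma represents_lissajous_word:
  assumes "(m, n) \<in> P0"
  defines "l \<equiv> \<bar>ell m n\<bar>" and "M \<equiv> \<bar>m\<bar>"
  shows "\<exists>P. represents (lissajous_word m n) P \<and>
    tr2 P = tr2 (seq_prod
      (\<lambda>k. turn ((l * (2 * int k - 1)) div (2 * M)) ((l * (2 * int k + 1)) div (2 * M))) 0 (2 * nat M))"
proof -
  note P0 = P0_facts[OF assms(1), folded l_def M_def]
  define E where "E k = (l * (2 * k - 1)) div (2 * M)" for k
  define A where "A = \<sigma>1 * \<sigma>2 * \<sigma>1"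
  define B where "B = \<sigma>1 * \<sigma>2"
  define \<epsilon> where "\<epsilon> = eps m n"
  have \<epsilon>: "\<epsilon> k = exponent_sign (E k)" for k
    by (simp add: \<epsilon>_def E_def l_def M_def eps_eq_exponent_sign[OF assms(1)])
  \<comment> \<open>Index 0 lies before the word. \<open>E 0\<close> and \<open>E (2 * M)\<close>
    are both odd, so the turn at 0 also closes the cycle.\<close>
  have "E 0 = - 1" unfolding E_def by (rule int_div_pos_eq[where r = "2 * M - l"]) (use P0 in auto)
  have "E 1 = 0" unfolding E_def by (rule int_div_pos_eq[where r = l]) (use P0 in auto)
  have "E (2 * M) = 2 * l - 1" unfolding E_def
    by (rule int_div_pos_eq[where r = "2 * M - l"]) (use P0 in \<open>auto simp: algebra_simps\<close>)
  then have ends: "\<epsilon> 1 = - 1" "\<epsilon> (2 * M) = 1"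
    using \<open>E 1 = 0\<close> by (simp_all add: \<epsilon> exponent_sign_def) presburger
  define Q where "Q = seq_prod (\<lambda>k. turn (E (int k)) (E (int k + 1))) 1 (2 * nat M)"
  have full: "seq_prod (\<lambda>k. turn (E (int k)) (E (int k + 1))) 0 (2 * nat M) = Mat2 1 1 0 1 * Q"
    using P0(4) \<open>E 0 = - 1\<close> \<open>E 1 = 0\<close> by (simp add: Q_def seq_prod_Cons[of 0] turn_def)
  have "[2..2 * M] = map (\<lambda>k. int k + 1) [1..<2 * nat M]"
    by (rule nth_equalityI) auto
  then have Q': "represents
      (prod_list (map (\<lambda>k. A powi ((\<epsilon> (k - 1) - \<epsilon> k) div 2) * B powi \<epsilon> k) [2..2 * M])) Q"
    unfolding Q_def seq_prod_def \<epsilon> A_def B_def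
    by (simp only: map_map o_def add_diff_cancel_right') (intro represents_prod_list represents_turn)
  have word: "lissajous_word m n = A powi ((1 + sgn m) div 2) * inverse B *
      prod_list (map (\<lambda>k. A powi ((\<epsilon> (k - 1) - \<epsilon> k) div 2) * B powi \<epsilon> k) [2..2 * M]) *
      A powi ((1 - sgn m) div 2)"
    using ends by (simp add: lissajous_word_def Let_def A_def B_def \<epsilon>_def M_def)
  note A = represents_A[folded A_def] and B' = represents_inverse[OF represents_B[folded B_def]]
  have "\<exists>P. represents (lissajous_word m n) P \<and> tr2 P = tr2 (Mat2 1 1 0 1 * Q)"
  proof (cases "0 < m")
    case True
    then have "represents (lissajous_word m n) (Mat2 1 1 0 1 * Q)"
      using represents_mult[OF represents_mult[OF A B'] Q'] by (simp add: word)
    then show ?thesis by blast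
  next
    case False
    then have "sgn m = - 1" using P0(4) by (simp add: M_def)
    then have "represents (lissajous_word m n) (Mat2 0 (- 1) 1 1 * Q * Mat2 0 1 (- 1) 0)"
      using represents_mult[OF represents_mult[OF B' Q'] A] by (simp add: word)
    moreover have "tr2 (Mat2 0 (- 1) 1 1 * Q * Mat2 0 1 (- 1) 0) = tr2 (Mat2 1 1 0 1 * Q)"
      by (subst tr2_mult_commute) (simp add: mult.assoc[symmetric])
    ultimately show ?thesis by blast
  qed
  then show ?thesis
    by (simp add: full[symmetric] E_def algebra_simps)
qed

text \<open>On \<open>P0\<close> the number \<open>d\<close> is
  \<open>\<bar>n\<bar> - \<bar>m\<bar>\<close>, so \<open>- n / m\<close> equals
  \<open>(M + d) / M\<close> and the interval for the level becomes
  \<open>(3 * N - 2) * d \<le> M < (3 * N + 1) * d\<close>. These ranges tile, which gives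
  \<open>N = (M + 2 * d) div (3 * d)\<close>.\<close>

lemma level_facts:
  assumes "(m, n) \<in> P0"
  defines "M \<equiv> \<bar>m\<bar>" and "d \<equiv> 3 * \<bar>ell m n\<bar> - 2 * \<bar>m\<bar>"
  shows "1 \<le> level m n" "(3 * int (level m n) - 2) * d \<le> M" "M < (3 * int (level m n) + 1) * d"
    and "1 \<le> N \<Longrightarrow> (3 * int N - 2) * d \<le> M \<Longrightarrow> M < (3 * int N + 1) * d \<Longrightarrow> level m n = N"
proof -
  note P0 = P0_facts[OF assms(1)]
  have M: "0 < M" and d: "0 < d" and dM: "d \<le> M" using P0 by (auto simp: M_def d_def)
  have "M + d = \<bar>n\<bar>" using P0(3) by (simp add: M_def d_def)
  moreover have "m * n < 0" using assms(1) by (simp add: P0_def)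
  ultimately have "- (n * M) = (M + d) * m"
    by (auto simp: M_def mult_less_0_iff)
  then have "- (rat_of_int n * of_int M) = of_int (M + d) * of_int m"
    by (metis of_int_minus of_int_mult)
  then have ratio: "- rat_of_int n / rat_of_int m = of_int (M + d) / of_int M"
    by (subst frac_eq_eq) (use M P0(4) in auto)
  let ?P = "\<lambda>N. N \<ge> 1 \<and>
     (3 * rat_of_nat N + 2) / (3 * rat_of_nat N + 1) < - rat_of_int n / rat_of_int m \<and>
     - rat_of_int n / rat_of_int m \<le> (3 * rat_of_nat N - 1) / (3 * rat_of_nat N - 2)"
  have P_iff: "?P N \<longleftrightarrow> 1 \<le> N \<and> (3 * int N - 2) * d \<le> M \<and> M < (3 * int N + 1) * d" for N
  proof (cases "1 \<le> N")
    case True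
    then have pos: "0 < 3 * rat_of_nat N - 2" "0 < 3 * rat_of_nat N + 1" "0 < rat_of_int M"
      using M by simp_all
    have "(3 * rat_of_nat N + 2) / (3 * rat_of_nat N + 1) < of_int (M + d) / of_int M \<longleftrightarrow>
        rat_of_int ((3 * int N + 2) * M) < of_int ((M + d) * (3 * int N + 1))"
      using pos by (simp add: divide_less_eq less_divide_eq mult.commute)
    moreover have "of_int (M + d) / of_int M \<le> (3 * rat_of_nat N - 1) / (3 * rat_of_nat N - 2) \<longleftrightarrow>
        rat_of_int ((M + d) * (3 * int N - 2)) \<le> of_int ((3 * int N - 1) * M)"
      using pos by (simp add: divide_le_eq le_divide_eq mult.commute)
    ultimately show ?thesis
      unfolding ratio of_int_less_iff of_int_le_iff using True by (auto simp: algebra_simps)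
  qed simp
  have P_iff': "?P N \<longleftrightarrow> 1 \<le> N \<and> int N = (M + 2 * d) div (3 * d)" for N
  proof -
    have "(3 * int N - 2) * d \<le> M \<and> M < (3 * int N + 1) * d \<longleftrightarrow> int N = (M + 2 * d) div (3 * d)"
    proof
      assume "(3 * int N - 2) * d \<le> M \<and> M < (3 * int N + 1) * d"
      then show "int N = (M + 2 * d) div (3 * d)"
        by (intro int_div_pos_eq[symmetric, where r = "M + 2 * d - 3 * d * int N"])
          (simp_all add: algebra_simps)
    next
      assume "int N = (M + 2 * d) div (3 * d)"
      then have "M + 2 * d = 3 * d * int N + (M + 2 * d) mod (3 * d)" by simp
      moreover have "0 \<le> (M + 2 * d) mod (3 * d)" "(M + 2 * d) mod (3 * d) < 3 * d" using d by simp_all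
      ultimately have "3 * d * int N \<le> M + 2 * d" "M + 2 * d < 3 * d * int N + 3 * d" by linarith+
      then show "(3 * int N - 2) * d \<le> M \<and> M < (3 * int N + 1) * d" by (simp add: algebra_simps)
    qed
    then show ?thesis unfolding P_iff by blast
  qed
  have "1 \<le> (M + 2 * d) div (3 * d)"
    using d dM by (simp add: int_one_le_iff_zero_less pos_imp_zdiv_pos_iff)
  then have "?P (nat ((M + 2 * d) div (3 * d)))" unfolding P_iff' by auto
  moreover have uniq: "level m n = N" if "?P N" for N
    unfolding level_def by (rule the_equality[of ?P, OF that]) (use that P_iff' of_nat_eq_iff in metis)
  ultimately have "?P (level m n)" by metis
  then show "1 \<le> level m n" "(3 * int (level m n) - 2) * d \<le> M" "M < (3 * int (level m n) + 1) * d"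
    unfolding P_iff by blast+
  show "level m n = N" if "1 \<le> N" "(3 * int N - 2) * d \<le> M" "M < (3 * int N + 1) * d"
    by (rule uniq, rule P_iff[THEN iffD2]) (use that in blast)
qed

section \<open>Level and slope\<close>

lemma quotient_of_coprime_divide:
  assumes "coprime a b" "0 < b"
  shows "quotient_of (of_int a / of_int b) = (a, b)"
  using assms by (simp add: Fract_of_int_quotient[symmetric] quotient_of_Fract normalize_stable)

text \<open>The defining equations of \<open>p\<close> and \<open>q\<close> form a unimodular linear system in \<open>\<bar>ell m n\<bar>\<close> and
  \<open>\<bar>m\<bar>\<close>, which is inverted here.\<close>

lemma P0_params:
  assumes "(m, n) \<in> P0" and qp: "quotient_of (slope m n) = (q, p)"
  defines "N \<equiv> int (level m n)"
  shows "\<bar>ell m n\<bar> = (2 * N - 1) * (p + q) + 2 * q" "\<bar>m\<bar> = (3 * N - 2) * (p + q) + 3 * q"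
proof -
  define l where "l = \<bar>ell m n\<bar>"
  define M where "M = \<bar>m\<bar>"
  note P0 = P0_facts[OF assms(1), folded l_def M_def]
  note lev = level_facts(1-3)[OF assms(1), folded l_def M_def N_def]
  define p' where "p' = (3 * N + 1) * l - (2 * N + 1) * M"
  define q' where "q' = - (3 * N - 2) * l + (2 * N - 1) * M"
  have l: "l = (2 * N - 1) * (p' + q') + 2 * q'" and M: "M = (3 * N - 2) * (p' + q') + 3 * q'"
    by (simp_all add: p'_def q'_def algebra_simps)
  have "coprime q' p'"
  proof (rule coprimeI)
    fix c assume "c dvd q'" "c dvd p'"
    then have "c dvd l" by (metis l dvd_add dvd_mult)
    moreover have "c dvd M"
      using \<open>c dvd q'\<close> \<open>c dvd p'\<close> by (metis M dvd_add dvd_mult)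
    ultimately show "is_unit c" using P0(8) by (meson coprime_common_divisor)
  qed
  \<comment> \<open>Three times \<open>p'\<close> is
    \<open>(3 * N + 1) * (3 * l - 2 * M) - M\<close>, so this is the upper bound on \<open>M\<close>
    that defines the level.\<close>
  moreover have "0 < p'"
    using lev(3) by (simp add: p'_def algebra_simps)
  moreover have "slope m n = of_int q' / of_int p'"
    by (simp only: slope_def Let_def p'_def q'_def l_def M_def N_def)
  ultimately have "q' = q \<and> p' = p"
    using qp quotient_of_coprime_divide by simp
  then show "\<bar>ell m n\<bar> = (2 * N - 1) * (p + q) + 2 * q" "\<bar>m\<bar> = (3 * N - 2) * (p + q) + 3 * q"
    using l M by (simp_all add: l_def M_def)
qed

lemma LL_D:
  assumes "(N, \<xi>) \<in> LL" "quotient_of \<xi> = (q, p)"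
  shows "1 \<le> N" "0 \<le> q" "0 < p" "coprime q p" "odd (p + q)" "\<not> 3 dvd p + q"
proof -
  show "1 \<le> N" using assms(1) by (simp add: LL_def)
  show p: "0 < p" using quotient_of_denom_pos[OF assms(2)] .
  show "coprime q p" using quotient_of_coprime[OF assms(2)] .
  have "0 \<le> rat_of_int q / of_int p"
    using assms by (simp add: LL_def quotient_of_div[OF assms(2), symmetric])
  then show "0 \<le> q" using p by (simp add: zero_le_divide_iff)
  have c: "coprime (p + q) 6" using assms by (simp add: LL_def)
  show "odd (p + q)"
    using coprime_common_divisor[OF c, of 2] by auto
  show "\<not> 3 dvd p + q"
    using coprime_common_divisor[OF c, of 3] by auto
qed

text \<open>This makes \<open>inv_into P0 level_slope\<close> a true preimage on \<open>LL\<close>.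
  Level and slope prescribe the absolute values of \<open>m\<close> and \<open>ell m n\<close>; the
  residue of \<open>m\<close> modulo 3 then fixes their common sign.\<close>

lemma LL_subset_level_slope: "LL \<subseteq> level_slope ` P0"
proof
  fix x assume x: "x \<in> LL"
  obtain N' \<xi> where N': "x = (N', \<xi>)" by (cases x)
  obtain q p where qp: "quotient_of \<xi> = (q, p)" by (cases "quotient_of \<xi>")
  note LL = LL_D[OF x[unfolded N'] qp]
  define N where "N = int N'"
  have N: "1 \<le> N" using LL(1) by (simp add: N_def)
  define l where "l = (2 * N - 1) * (p + q) + 2 * q"
  define M where "M = (3 * N - 2) * (p + q) + 3 * q"
  have p: "p = (3 * N + 1) * l - (2 * N + 1) * M" and q: "q = - (3 * N - 2) * l + (2 * N - 1) * M"
    by (simp_all add: l_def M_def algebra_simps)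
  have d: "3 * l - 2 * M = p + q" by (simp add: l_def M_def algebra_simps)
  have N_mult: "p \<le> N * p" "q \<le> N * q"
    using mult_right_mono[of 1 N p] mult_right_mono[of 1 N q] N LL by simp_all
  have l': "l = 2 * (N * p) + 2 * (N * q) - p + q" and M': "M = 3 * (N * p) + 3 * (N * q) - 2 * p + q"
    by (simp_all add: l_def M_def algebra_simps)
  have M_pos: "0 < M" and lM: "l \<le> M" and l_pos: "0 < l"
    using N_mult LL(2,3) l' M' by linarith+
  have "odd l" using LL(5) by (simp add: l_def)
  have "M = (p + q) + 3 * ((N - 1) * (p + q) + q)" by (simp add: M_def algebra_simps)
  then have "\<not> 3 dvd M" using LL(6) by (metis dvd_add_times_triv_right_iff mult.commute)
  have "coprime M l"
  proof (rule coprimeI)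
    fix c assume "c dvd M" "c dvd l"
    then have "c dvd q" by (metis q dvd_add dvd_mult)
    moreover have "c dvd p"
      using \<open>c dvd M\<close> \<open>c dvd l\<close> by (metis p dvd_diff dvd_mult)
    ultimately show "is_unit c" using LL(4) by (meson coprime_common_divisor)
  qed
  moreover have "coprime M 3"
    using prime_imp_coprime[of "3 :: int" M] \<open>\<not> 3 dvd M\<close> by (simp add: coprime_commute)
  ultimately have "coprime M (3 * l)" by simp
  \<comment> \<open>As 3 does not divide \<open>M\<close>, exactly one of \<open>M\<close> and
    \<open>- M\<close> is 1 modulo 3.\<close>
  define s :: int where "s = (if M mod 3 = 1 then 1 else - 1)"
  have s: "s = 1 \<or> s = - 1" by (simp add: s_def)
  define m where "m = s * M"
  define n where "n = m - 3 * (s * l)"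
  have "(m - 1) mod 3 = 0"
    using \<open>\<not> 3 dvd M\<close> unfolding m_def s_def by (simp, presburger)
  then have m1: "[m = 1] (mod 3)" by (simp add: cong_iff_dvd_diff mod_eq_0_iff_dvd)
  then have n1: "[n = 1] (mod 3)" by (simp add: n_def cong_iff_dvd_diff) presburger
  have ell: "ell m n = s * l" by (simp add: ell_def n_def)
  have "coprime m n"
  proof -
    have "coprime M (3 * l - M)"
      using \<open>coprime M (3 * l)\<close> by (simp add: coprime_iff_gcd_eq_1 gcd.commute[of M] gcd_diff1)
    moreover have "m = s * M" "n = - s * (3 * l - M)" by (simp_all add: m_def n_def algebra_simps)
    ultimately show ?thesis using s by auto
  qed
  moreover have "\<not> [m = n] (mod 6)"
  proof
    assume "[m = n] (mod 6)"
    then have "6 dvd 3 * (s * l)" by (simp add: n_def cong_iff_dvd_diff)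
    then obtain k where "3 * (s * l) = 6 * k" by (elim dvdE)
    then have "s * l = 2 * k" by linarith
    then have "even (s * l)" by simp
    with s \<open>odd l\<close> show False by auto
  qed
  moreover have "m * n < 0" "\<bar>m\<bar> < \<bar>n\<bar>" "\<bar>n\<bar> \<le> 2 * \<bar>m\<bar>"
  proof -
    have "m * n = - (M * (3 * l - M))" using s by (auto simp: m_def n_def algebra_simps)
    moreover have "M < 3 * l - M" using d LL(2,3) by simp
    ultimately show "m * n < 0" using M_pos by simp
    have "\<bar>m\<bar> = M" "\<bar>n\<bar> = 3 * l - M"
      using s M_pos \<open>M < 3 * l - M\<close> by (auto simp: m_def n_def)
    then show "\<bar>m\<bar> < \<bar>n\<bar>" "\<bar>n\<bar> \<le> 2 * \<bar>m\<bar>" using \<open>M < 3 * l - M\<close> lM by simp_all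
  qed
  ultimately have P0: "(m, n) \<in> P0" using m1 n1 by (simp add: P0_def)
  have "\<bar>ell m n\<bar> = l" using s l_pos by (auto simp: ell)
  moreover have "\<bar>m\<bar> = M" using s M_pos by (auto simp: m_def)
  ultimately have abs: "\<bar>ell m n\<bar> = l" "\<bar>m\<bar> = M" .
  have "level m n = N'"
    by (rule level_facts(4)[OF P0, unfolded abs d])
      (use LL in \<open>simp_all add: N_def[symmetric] M_def algebra_simps\<close>)
  moreover have "slope m n = \<xi>"
    unfolding slope_def Let_def abs \<open>level m n = N'\<close> N_def[symmetric] p[symmetric] q[symmetric]
    by (rule quotient_of_div[OF qp, symmetric])
  ultimately show "x \<in> level_slope ` P0"
    using P0 by (force simp: level_slope_def N')
qed

text \<open>Offset 0 is the normalisation in which prefixes and suffixes of Christoffel words are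
  visible. Two periods are taken because shears pair up while \<open>n\<close> is odd in the
  application.\<close>

definition trace_at :: "int \<Rightarrow> int \<Rightarrow> int \<Rightarrow> int" where
  "trace_at N q n = tr2 (seq_prod (\<lambda>i. cf_mat (cf_digit N 0 q n i)) 0 (2 * nat n))"

lemma cf_digit_periodic:
  assumes "0 < n"
  shows "cf_digit N h q n (i + j * nat n) = cf_digit N h q n i"
proof -
  have "height h q n (i + j * nat n) = height h q n i + q * int j" for i
  proof -
    have "q * int (i + j * nat n) + h = (q * int i + h) + (q * int j) * n"
      using assms by (simp add: algebra_simps)
    then show ?thesis
      using assms by (simp only: height_def div_mult_self1[of n "q * int i + h"])
  qed
  from this[of i] this[of "Suc i"] show ?thesis by (simp add: cf_digit_def)
qed

text \<open>As \<open>q\<close> is invertible modulo \<open>n\<close>, changing the offset \<open>h\<close> rotates the periodic sequence of digits.\<close>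

lemma trace_at_offset:
  assumes "0 < n" "coprime q n"
  shows "tr2 (seq_prod (\<lambda>i. cf_mat (cf_digit N h q n i)) 0 (2 * nat n)) = trace_at N q n"
proof -
  obtain x where "[q * x = 1] (mod n)" using cong_solve_coprime_int[OF assms(2)] by blast
  then have "[q * x * h = 1 * h] (mod n)" by (rule cong_scalar_right)
  \<comment> \<open>Shifting the index by \<open>i0\<close> adds \<open>q * i0\<close> to the
    numerator, which agrees with \<open>h\<close> modulo \<open>n\<close>; heights then change by a
    constant and digits not at all.\<close>
  define i0 where "i0 = nat ((x * h) mod n)"
  have "[q * int i0 = h] (mod n)"
  proof -
    have "[int i0 = x * h] (mod n)" using assms(1) by (simp add: i0_def cong_def)
    then have "[q * int i0 = q * (x * h)] (mod n)" by (rule cong_scalar_left)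
    with \<open>[q * x * h = 1 * h] (mod n)\<close> show ?thesis by (simp add: mult.assoc cong_def)
  qed
  then obtain t where t: "q * int i0 = h + n * t"
    by (metis cong_iff_lin cong_sym)
  have "height 0 q n (i + i0) = height h q n i + t" for i
  proof -
    have "q * int (i + i0) + 0 = (q * int i + h) + t * n"
      using t by (simp add: algebra_simps)
    then show ?thesis
      using assms by (simp only: height_def div_mult_self1[of n "q * int i + h"])
  qed
  then have "cf_digit N h q n i = cf_digit N 0 q n (i + i0)" for i
    using \<open>\<And>i. height 0 q n (i + i0) = height h q n i + t\<close>[of "Suc i"] by (simp add: cf_digit_def)
  then have "seq_prod (\<lambda>i. cf_mat (cf_digit N h q n i)) 0 (2 * nat n) =
      seq_prod (\<lambda>i. cf_mat (cf_digit N 0 q n i)) i0 (i0 + 2 * nat n)"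
    using seq_prod_shift[of "\<lambda>i. cf_mat (cf_digit N 0 q n i)" 0 i0 "2 * nat n"] by (simp add: add.commute)
  then show ?thesis
    unfolding trace_at_def
    by (simp only: tr2_seq_prod_periodic cf_digit_periodic[OF assms(1)])
qed

lemma trace_at_eq_square:
  fixes N q n :: int
  assumes "0 < n"
  defines "P \<equiv> seq_prod (\<lambda>i. cf_mat (cf_digit N 0 q n i)) 0 (nat n)"
  shows "trace_at N q n = tr2 (P * P)"
proof -
  let ?f = "\<lambda>i. cf_mat (cf_digit N 0 q n i)"
  have "seq_prod ?f (nat n) (2 * nat n) = P"
    using seq_prod_shift[of ?f 0 "nat n" "nat n"] cf_digit_periodic[OF assms(1), of N 0 q _ 1]
    by (simp add: P_def mult_2)
  then show ?thesis
    by (simp add: trace_at_def seq_prod_split[of 0 "nat n" "2 * nat n"] P_def)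
qed

lemma trace_at_ge_2:
  assumes "1 \<le> N" "0 \<le> q" "0 < n"
  shows "2 \<le> trace_at N q n"
proof -
  have "cf_mat 1 * cf_mat 1 \<preceq> seq_prod (\<lambda>i. cf_mat (cf_digit N 0 q n i)) 0 (2 * nat n)"
    using assms by (intro seq_prod_cf_mat_even cf_digit_ge_1) auto
  from tr2_mono[OF this] show ?thesis by (simp add: trace_at_def cf_mat_def)
qed

text \<open>The chain runs from the word to its cutting sequence with rounding offset, then by
  rotation to offset 0, and by conjugation to any member of the class.\<close>

lemma dilatation_lissajous_class_at:
  assumes "(N, \<xi>) \<in> LL" "quotient_of \<xi> = (q, p)" "x \<in> lissajous_class_at (N, \<xi>)"
  shows "dilatation x = dil_of_trace (trace_at (int N) q (p + q))"
proof -
  note LL = LL_D[OF assms(1,2)]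
  obtain m n where mn: "inv_into P0 level_slope (N, \<xi>) = (m, n)" by fastforce
  have "(N, \<xi>) \<in> level_slope ` P0" using LL_subset_level_slope assms(1) by blast
  from inv_into_into[OF this] f_inv_into_f[OF this]
  have P0: "(m, n) \<in> P0" and "level_slope (m, n) = (N, \<xi>)" by (simp_all only: mn)
  then have lev: "level m n = N" "slope m n = \<xi>" by (simp_all add: level_slope_def)
  have x: "x \<in> conj_class (lissajous_word m n)"
    using assms(3) by (simp add: lissajous_class_at_def mn lissajous_class_def)
  note params = P0_params[OF P0, unfolded lev, OF assms(2)]
  have N: "1 \<le> int N" using LL(1) by simp
  have n: "0 < p + q" using LL by simp
  obtain P where P: "represents (lissajous_word m n) P"
    "tr2 P = tr2 (seq_prod
      (\<lambda>i. cf_mat (cf_digit (int N) ((p + q - 1) div 2) q (p + q) i)) 0 (2 * nat (p + q)))"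
    using represents_lissajous_word[OF P0]
      seq_prod_cutting_sequence[OF N n LL(5,2) params] by auto
  moreover have "coprime q (p + q)"
    using LL(4) by (metis add.commute coprime_iff_gcd_eq_1 gcd_add2)
  ultimately have "tr2 P = trace_at (int N) q (p + q)"
    using trace_at_offset[OF n] by simp
  with represents_conj_class[OF x P(1)] obtain Q where
    Q: "represents x Q" "tr2 Q = trace_at (int N) q (p + q)" by auto
  then show ?thesis
    using dilatation_represents[OF Q(1)] trace_at_ge_2[OF N LL(2) n] by simp
qed

section \<open>Monotonicity\<close>

lemma trace_at_level_mono:
  assumes "1 \<le> N" "0 \<le> q" "0 < n"
  shows "trace_at N q n < trace_at (N + 1) q n"
  unfolding trace_at_def using assms
  by (intro tr2_seq_prod_cf_mat_strict_mono cf_digit_ge_1) (auto simp: cf_digit_def)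

text \<open>No fraction strictly between the neighbours \<open>s / m\<close> and \<open>s' / m'\<close> has denominator at most \<open>m\<close>, so
  replacing \<open>s / m\<close> by a slope between them leaves the first \<open>m\<close> heights unchanged.\<close>

lemma height_prefix:
  assumes "s' * m - s * m' = 1" "0 < m" "0 < m'" "0 < \<alpha>" "0 < \<beta>" "int i \<le> m"
  shows "height 0 (\<alpha> * s + \<beta> * s') (\<alpha> * m + \<beta> * m') i = height 0 s m i"
proof -
  define f where "f = height 0 s m i"
  have f: "f * m \<le> s * int i" "s * int i < (f + 1) * m"
    using height_bounds[OF assms(2), where h = 0 and q = s and i = i] by (simp_all add: f_def)
  have "f * m' \<le> s' * int i"
  proof -
    have "m * (s' * int i - f * m') = int i * (s' * m - s * m') + m' * (s * int i - f * m)"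
      by (simp add: algebra_simps)
    also have "\<dots> \<ge> 0" using f(1) assms(1,3) by simp
    finally show ?thesis using assms(2) by (simp add: zero_le_mult_iff)
  qed
  moreover have "s' * int i \<le> (f + 1) * m'"
  proof (rule ccontr)
    assume "\<not> s' * int i \<le> (f + 1) * m'"
    then have "m * 1 \<le> m * (s' * int i - (f + 1) * m')"
      using assms(2) by (intro mult_left_mono) auto
    moreover have "m' * 1 \<le> m' * ((f + 1) * m - s * int i)"
      using assms(3) f(2) by (intro mult_left_mono) auto
    \<comment> \<open>The determinant condition makes \<open>i\<close> a positive combination of
      \<open>m\<close> and \<open>m'\<close>, hence larger than \<open>m\<close>.\<close>
    moreover have "int i = m * (s' * int i - (f + 1) * m') + m' * ((f + 1) * m - s * int i)"
    proof -
      have "int i * (s' * m - s * m') =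
          m * (s' * int i - (f + 1) * m') + m' * ((f + 1) * m - s * int i)"
        by (simp add: algebra_simps)
      then show ?thesis by (simp only: assms(1) mult_1_right)
    qed
    ultimately show False using assms(3,6) by linarith
  qed
  ultimately have "\<alpha> * (f * m) + \<beta> * (f * m') \<le> \<alpha> * (s * int i) + \<beta> * (s' * int i)"
    and "\<alpha> * (s * int i) + \<beta> * (s' * int i) < \<alpha> * ((f + 1) * m) + \<beta> * ((f + 1) * m')"
    using f assms(4,5) by (intro add_mono mult_left_mono add_less_le_mono mult_strict_left_mono; simp)+
  then have "((\<alpha> * s + \<beta> * s') * int i) div (\<alpha> * m + \<beta> * m') = f"
    by (intro int_div_pos_eq[where r = "(\<alpha> * s + \<beta> * s') * int i - (\<alpha> * m + \<beta> * m') * f"])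
      (simp_all add: algebra_simps)
  then show ?thesis by (simp add: height_def f_def)
qed

text \<open>The mirror image of \<open>height_prefix\<close>, for a combination of smaller slope:
  counting from the far end by \<open>t = m - i\<close> turns floors into ceilings, and
  \<open>h\<close> is the ceiling of \<open>s * t / m\<close>.\<close>

lemma height_suffix:
  assumes "s * m' - s' * m = 1" "0 < m" "0 < m'" "0 < \<alpha>" "0 < \<beta>" "int i \<le> m"
    and k: "int k = \<alpha> * m + \<beta> * m' - m"
  shows "height 0 (\<alpha> * s + \<beta> * s') (\<alpha> * m + \<beta> * m') (k + i) =
    height 0 s m i + (\<alpha> * s + \<beta> * s' - s)"
proof -
  define f where "f = height 0 s m i"
  define t where "t = m - int i"
  define h where "h = s - f"
  have "f * m \<le> s * int i" "s * int i < (f + 1) * m"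
    using height_bounds[OF assms(2), where h = 0 and q = s and i = i] by (simp_all add: f_def)
  then have h: "s * t \<le> h * m" "(h - 1) * m < s * t"
    by (simp_all add: h_def t_def algebra_simps)
  have t: "0 \<le> t" "t \<le> m" using assms(6) by (simp_all add: t_def)
  have "s' * t \<le> h * m'"
  proof -
    have "m * (h * m' - s' * t) = t * (s * m' - s' * m) + m' * (h * m - s * t)"
      by (simp add: algebra_simps)
    also have "\<dots> \<ge> 0" using h(1) assms(1,3) t(1) by simp
    finally show ?thesis using assms(2) by (simp add: zero_le_mult_iff)
  qed
  moreover have "(h - 1) * m' \<le> s' * t"
  proof (rule ccontr)
    assume "\<not> (h - 1) * m' \<le> s' * t"
    then have "m * 1 \<le> m * ((h - 1) * m' - s' * t)"
      using assms(2) by (intro mult_left_mono) auto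
    moreover have "m' * 1 \<le> m' * (s * t - (h - 1) * m)"
      using assms(3) h(2) by (intro mult_left_mono) auto
    moreover have "t = m * ((h - 1) * m' - s' * t) + m' * (s * t - (h - 1) * m)"
    proof -
      have "t * (s * m' - s' * m) =
          m * ((h - 1) * m' - s' * t) + m' * (s * t - (h - 1) * m)"
        by (simp add: algebra_simps)
      then show ?thesis by (simp only: assms(1) mult_1_right)
    qed
    ultimately show False using assms(3) t(2) by linarith
  qed
  ultimately have "\<alpha> * (s * t) + \<beta> * (s' * t) \<le> \<alpha> * (h * m) + \<beta> * (h * m')"
    and "\<alpha> * ((h - 1) * m) + \<beta> * ((h - 1) * m') < \<alpha> * (s * t) + \<beta> * (s' * t)"
    using h assms(4,5) by (intro add_mono mult_left_mono add_less_le_mono mult_strict_left_mono; simp)+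
  then have "((\<alpha> * s + \<beta> * s') * (\<alpha> * m + \<beta> * m' - t)) div (\<alpha> * m + \<beta> * m') = \<alpha> * s + \<beta> * s' - h"
    by (intro int_div_pos_eq[where r = "(\<alpha> * m + \<beta> * m') * h - (\<alpha> * s + \<beta> * s') * t"])
      (simp_all add: algebra_simps)
  moreover have "int (k + i) = \<alpha> * m + \<beta> * m' - t" using k by (simp add: t_def)
  ultimately show ?thesis by (simp only: height_def f_def h_def) simp
qed

text \<open>A combination of slope above \<open>s / m\<close> has the word of \<open>s / m\<close>
  as a prefix, one of slope below has it as a suffix. Both lengths being odd, the remaining factor
  \<open>Q\<close> has even length.\<close>

lemma trace_at_combination_mono:
  assumes N: "1 \<le> N" and s: "0 \<le> s" "0 \<le> s'" and m: "0 < m" "0 < m'" and ab: "0 < \<alpha>" "0 < \<beta>"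
    and det: "s' * m - s * m' = 1 \<or> s * m' - s' * m = 1"
    and odd: "odd m" "odd (\<alpha> * m + \<beta> * m')"
  shows "trace_at N s m < trace_at N (\<alpha> * s + \<beta> * s') (\<alpha> * m + \<beta> * m')"
proof -
  define q where "q = \<alpha> * s + \<beta> * s'"
  define n where "n = \<alpha> * m + \<beta> * m'"
  define f where "f i = cf_mat (cf_digit N 0 q n i)" for i
  define g where "g i = cf_mat (cf_digit N 0 s m i)" for i
  have "m \<le> \<alpha> * m" "0 < \<beta> * m'" using m ab by simp_all
  then have mn: "m < n" by (simp add: n_def)
  have q: "0 \<le> q" using s ab by (simp add: q_def)
  define k where "k = nat n - nat m"
  have k: "int k = n - m" "even k" "0 < k" "nat n = nat m + k"
    using mn m odd by (auto simp: k_def n_def even_nat_iff)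
  have digit: "1 \<le> cf_digit N 0 q n i" "1 \<le> cf_digit N 0 s m i" for i
    using cf_digit_ge_1[OF N] q s m mn by simp_all
  define P where "P = seq_prod g 0 (nat m)"
  have P: "cf_mat 1 \<preceq> P"
    unfolding P_def g_def
    by (rule seq_prod_cf_mat_odd) (use digit m odd in \<open>auto simp: even_nat_iff\<close>)
  have "\<exists>Q. cf_mat 1 * cf_mat 1 \<preceq> Q \<and> (seq_prod f 0 (nat n) = P * Q \<or> seq_prod f 0 (nat n) = Q * P)"
    using det
  proof
    assume "s' * m - s * m' = 1"
    then have "height 0 q n i = height 0 s m i" if "int i \<le> m" for i
      unfolding q_def n_def using m ab that by (rule height_prefix)
    then have "seq_prod f 0 (nat m) = P"
      unfolding P_def by (intro seq_prod_cong) (simp add: f_def g_def cf_digit_def)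
    moreover have "seq_prod f 0 (nat n) = seq_prod f 0 (nat m) * seq_prod f (nat m) (nat n)"
      using k by (intro seq_prod_split) auto
    moreover have "cf_mat 1 * cf_mat 1 \<preceq> seq_prod f (nat m) (nat n)"
      unfolding f_def by (rule seq_prod_cf_mat_even) (use digit k in auto)
    ultimately show ?thesis by metis
  next
    assume "s * m' - s' * m = 1"
    then have shift: "height 0 q n (k + i) = height 0 s m i + (q - s)" if "int i \<le> m" for i
      unfolding q_def n_def using m ab that k(1)[unfolded n_def] by (rule height_suffix)
    \<comment> \<open>A digit compares two consecutive heights, so agreement up to and including
      index \<open>m\<close> is used.\<close>
    have "cf_digit N 0 q n (k + i) = cf_digit N 0 s m i" if "int i < m" for i
      using shift[of i] shift[of "Suc i"] that by (simp add: cf_digit_def)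
    then have "seq_prod f k (nat n) = P"
      unfolding P_def k(4) using seq_prod_shift[of f 0 k "nat m"]
      by (simp add: add.commute) (rule seq_prod_cong, simp add: f_def g_def add.commute)
    moreover have "seq_prod f 0 (nat n) = seq_prod f 0 k * seq_prod f k (nat n)"
      using k by (intro seq_prod_split) auto
    moreover have "cf_mat 1 * cf_mat 1 \<preceq> seq_prod f 0 k"
      unfolding f_def by (rule seq_prod_cf_mat_even) (use digit k in auto)
    ultimately show ?thesis by metis
  qed
  then obtain Q where Q: "cf_mat 1 * cf_mat 1 \<preceq> Q"
    and "seq_prod f 0 (nat n) = P * Q \<or> seq_prod f 0 (nat n) = Q * P" by blast
  \<comment> \<open>Cyclic invariance of the trace identifies the suffix case with the prefix
    case.\<close>
  then have "tr2 (seq_prod f 0 (nat n) * seq_prod f 0 (nat n)) = tr2 ((P * Q) * (P * Q))"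
    using tr2_mult_commute[of Q "P * (Q * P)"] by (auto simp: mult.assoc)
  with tr2_square_strict_mono[OF P Q] show ?thesis
    using m mn by (simp add: trace_at_eq_square q_def[symmetric] n_def[symmetric] f_def[abs_def] g_def[abs_def] P_def)
qed

section \<open>Combinations of neighbours in the Stern-Brocot tree\<close>

lemma sb_neighbours_det:
  "(case sb_neighbours u of ((q, p), (q', p')) \<Rightarrow> q' * p = q * p' + 1)"
  by (induction u rule: sb_neighbours.induct)
    (auto simp: mediant_def algebra_simps split: prod.splits)

text \<open>Positivity of \<open>a\<close> and \<open>d\<close> ensures that the mediant of the new
  neighbours involves both neighbours of \<open>w\<close>.\<close>

lemma sb_neighbours_append:
  assumes "sb_neighbours w = ((q, p), (q', p'))"
  shows "\<exists>a b c d. sb_neighbours (v @ w) =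
      ((a * q + b * q', a * p + b * p'), (c * q + d * q', c * p + d * p')) \<and> 1 \<le> a \<and> 1 \<le> d"
proof (induction v)
  case Nil
  show ?case
    by (rule exI[of _ 1], rule exI[of _ 0], rule exI[of _ 0], rule exI[of _ 1]) (simp add: assms)
next
  case (Cons x v)
  then obtain a b c d where
    IH: "sb_neighbours (v @ w) =
      ((a * q + b * q', a * p + b * p'), (c * q + d * q', c * p + d * p'))" "1 \<le> a" "1 \<le> d" by blast
  show ?case
  proof (cases x)
    case Left
    then show ?thesis using IH
      by (intro exI[of _ a] exI[of _ b] exI[of _ "a + c"] exI[of _ "b + d"])
        (simp add: mediant_def algebra_simps)
  next
    case Right
    then show ?thesis using IH
      by (intro exI[of _ "a + c"] exI[of _ "b + d"] exI[of _ c] exI[of _ d])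
        (simp add: mediant_def algebra_simps)
  qed
qed

lemma sb_mediant_append:
  assumes "sb_neighbours w = ((q, p), (q', p'))"
  shows "\<exists>\<alpha> \<beta>. 0 < \<alpha> \<and> 0 < \<beta> \<and> mediant (sb_neighbours (v @ w)) = (\<alpha> * q + \<beta> * q', \<alpha> * p + \<beta> * p')"
proof -
  obtain a b c d where "sb_neighbours (v @ w) =
      ((a * q + b * q', a * p + b * p'), (c * q + d * q', c * p + d * p'))" "1 \<le> a" "1 \<le> d"
    using sb_neighbours_append[OF assms] by blast
  then show ?thesis
    by (intro exI[of _ "a + c"] exI[of _ "b + d"]) (simp add: mediant_def algebra_simps)
qed

lemma quotient_of_sb_vertex:
  assumes "mediant (sb_neighbours u) = (q, p)"
  shows "quotient_of (sb_vertex u) = (int q, int p)"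
proof -
  obtain q1 p1 q2 p2 where nb: "sb_neighbours u = ((q1, p1), (q2, p2))" by (metis surj_pair)
  with sb_neighbours_det[of u] have "q2 * p1 = q1 * p2 + 1" by simp
  then have det: "int q2 * int p1 - int q1 * int p2 = 1"
    by (metis add_diff_cancel_left' of_nat_1 of_nat_add of_nat_mult)
  have qp: "q = q1 + q2" "p = p1 + p2" using assms nb by (simp_all add: mediant_def)
  have "coprime (int q) (int p)"
  proof (rule coprimeI)
    fix c assume c: "c dvd int q" "c dvd int p"
    then have "c dvd int q * int p1 - int q1 * int p" by (intro dvd_diff dvd_mult dvd_mult2)
    also have "int q * int p1 - int q1 * int p = 1" using det by (simp add: qp algebra_simps)
    finally show "is_unit c" .
  qed
  moreover have "0 < int p" using \<open>q2 * p1 = q1 * p2 + 1\<close> by (cases p1) (auto simp: qp)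
  ultimately show ?thesis
    using quotient_of_coprime_divide[of "int q" "int p"] by (simp add: sb_vertex_def assms)
qed

text \<open>The first step from \<eta> towards \<xi> replaces one neighbour of \<eta> by \<eta>
  itself, so \<xi> is a positive combination of \<eta> and the neighbour that remains.\<close>

lemma trace_at_descendant_mono:
  assumes "sb_descendant \<xi> \<eta>" "1 \<le> N"
    and qp: "quotient_of \<xi> = (q, p)" "odd (p + q)" and sr: "quotient_of \<eta> = (s, r)" "odd (r + s)"
  shows "trace_at N s (r + s) < trace_at N q (p + q)"
proof -
  obtain u v where "v \<noteq> []" and \<eta>: "\<eta> = sb_vertex u" and \<xi>: "\<xi> = sb_vertex (v @ u)"
    using assms(1) by (auto simp: sb_descendant_def)
  \<comment> \<open>Addresses carry the last step at the head, so the first step below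
    \<open>u\<close> is the last entry of \<open>v\<close>.\<close>
  then obtain v' x where v: "v = v' @ [x]" by (metis rev_exhaust)
  obtain q1 p1 q2 p2 where nb: "sb_neighbours u = ((q1, p1), (q2, p2))" by (metis surj_pair)
  with sb_neighbours_det[of u] have det: "q2 * p1 = q1 * p2 + 1" by simp
  then have det': "int q2 * int p1 = int q1 * int p2 + 1"
    by (metis of_nat_1 of_nat_add of_nat_mult)
  have pos: "0 < q2" "0 < p1" using det by (auto intro: Nat.gr0I)
  have sr': "s = int q1 + int q2" "r = int p1 + int p2"
    using sr(1) quotient_of_sb_vertex[of u "q1 + q2" "p1 + p2"] nb by (simp_all add: \<eta> mediant_def)
  \<comment> \<open>The fraction \<open>s' / r'\<close> is the remaining neighbour, the left one in
    the left subtree. It may be \<open>1/0\<close>, so positivity is claimed only for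
    \<open>r' + s'\<close>.\<close>
  obtain s' r' \<alpha> \<beta> where comb: "0 < \<alpha>" "0 < \<beta>" "0 < int r' + int s'"
    "q = int \<alpha> * s + int \<beta> * int s'" "p = int \<alpha> * r + int \<beta> * int r'"
    "int s' * r - s * int r' = 1 \<or> s * int r' - int s' * r = 1"
  proof (cases x)
    case Left
    then have "sb_neighbours (x # u) = ((q1, p1), (q1 + q2, p1 + p2))" by (simp add: nb mediant_def)
    from sb_mediant_append[OF this, of v'] obtain a b where ab: "0 < a" "0 < b"
      "mediant (sb_neighbours (v @ u)) = (a * q1 + b * (q1 + q2), a * p1 + b * (p1 + p2))"
      by (auto simp: v)
    with qp(1) quotient_of_sb_vertex[OF ab(3)] pos det' show ?thesis
      by (intro that[of b a p1 q1]) (simp_all add: \<xi> sr' algebra_simps)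
  next
    case Right
    then have "sb_neighbours (x # u) = ((q1 + q2, p1 + p2), (q2, p2))" by (simp add: nb mediant_def)
    from sb_mediant_append[OF this, of v'] obtain a b where ab: "0 < a" "0 < b"
      "mediant (sb_neighbours (v @ u)) = (a * (q1 + q2) + b * q2, a * (p1 + p2) + b * p2)"
      by (auto simp: v)
    with qp(1) quotient_of_sb_vertex[OF ab(3)] pos det' show ?thesis
      by (intro that[of a b p2 q2]) (simp_all add: \<xi> sr' algebra_simps)
  qed
  have n: "p + q = int \<alpha> * (r + s) + int \<beta> * (int r' + int s')" by (simp add: comb algebra_simps)
  \<comment> \<open>Passing from \<open>(s, r)\<close> to \<open>(s, r + s)\<close> preserves
    determinants, so adjacency in the tree is adjacency of the slopes with denominators
    \<open>r + s\<close> and \<open>r' + s'\<close>.\<close>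
  have "trace_at N s (r + s) <
      trace_at N (int \<alpha> * s + int \<beta> * int s') (int \<alpha> * (r + s) + int \<beta> * (int r' + int s'))"
    by (rule trace_at_combination_mono)
      (use assms(2) comb pos sr(2) qp(2) in \<open>auto simp: sr' n[symmetric] algebra_simps\<close>)
  then show ?thesis by (simp only: n comb(4)[symmetric])
qed

theorem theorem1p2:
  fixes W :: "nat \<times> rat \<Rightarrow> braid3"
  assumes W: "\<And>x. x \<in> LL \<Longrightarrow> W x \<in> lissajous_class_at x"
  shows "(\<forall>N \<xi>. (N, \<xi>) \<in> LL \<longrightarrow> dilatation (W (N, \<xi>)) < dilatation (W (N + 1, \<xi>))) \<and>
    (\<forall>N \<eta> \<xi>. (N, \<eta>) \<in> LL \<longrightarrow> (N, \<xi>) \<in> LL \<longrightarrow> sb_descendant \<xi> \<eta> \<longrightarrow>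
      dilatation (W (N, \<eta>)) < dilatation (W (N, \<xi>)))"
proof (intro conjI allI impI)
  fix N \<xi> assume LL: "(N, \<xi>) \<in> LL"
  obtain q p where qp: "quotient_of \<xi> = (q, p)" by (cases "quotient_of \<xi>")
  note D = LL_D[OF LL qp]
  have LL': "(N + 1, \<xi>) \<in> LL" using LL by (simp add: LL_def)
  have "trace_at (int N) q (p + q) < trace_at (int (N + 1)) q (p + q)"
    using trace_at_level_mono[of "int N" q "p + q"] D by (simp add: add.commute)
  moreover have "2 \<le> trace_at (int N) q (p + q)" using D by (intro trace_at_ge_2) auto
  ultimately show "dilatation (W (N, \<xi>)) < dilatation (W (N + 1, \<xi>))"
    unfolding dilatation_lissajous_class_at[OF LL qp W[OF LL]]
      dilatation_lissajous_class_at[OF LL' qp W[OF LL']]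
    by (intro dil_of_trace_strict_mono)
next
  fix N \<eta> \<xi> assume LL: "(N, \<eta>) \<in> LL" "(N, \<xi>) \<in> LL" and desc: "sb_descendant \<xi> \<eta>"
  obtain q p where qp: "quotient_of \<xi> = (q, p)" by (cases "quotient_of \<xi>")
  obtain s r where sr: "quotient_of \<eta> = (s, r)" by (cases "quotient_of \<eta>")
  note D = LL_D[OF LL(1) sr] and D' = LL_D[OF LL(2) qp]
  have "trace_at (int N) s (r + s) < trace_at (int N) q (p + q)"
    using D D' by (intro trace_at_descendant_mono[OF desc _ qp _ sr]) auto
  moreover have "2 \<le> trace_at (int N) s (r + s)" using D by (intro trace_at_ge_2) auto
  ultimately show "dilatation (W (N, \<eta>)) < dilatation (W (N, \<xi>))"
    unfolding dilatation_lissajous_class_at[OF LL(1) sr W[OF LL(1)]]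
      dilatation_lissajous_class_at[OF LL(2) qp W[OF LL(2)]]
    by (intro dil_of_trace_strict_mono)
qed

end
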